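(* Let $\{\alpha_j\}_{j=0}^\infty\subset\mathbb{D}$ be a sequence of Verblunsky coefficients with $\sup_j|\alpha_j|<1$, and let $\mathcal{C}(\alpha)$ be its CMV matrix. Let $\mathcal{R}$ be the set of right limits $\tilde{\mathcal{C}}(\beta)$ of $\mathcal{C}(\alpha)$ (extended CMV matrices). Then $$\sigma_{\mathrm{ess}}(\mathcal{C}(\alpha))=\overline{\bigcup_{\tilde{\mathcal{C}}(\beta)\in\mathcal{R}}\sigma(\tilde{\mathcal{C}}(\beta))}.$$
   Context: $\mathbb{D}=\{z\in\mathbb{C}:|z|<1\}$. For $\alpha\in\mathbb{D}$ put $\rho=(1-|\alpha|^2)^{1/2}$ and $\Theta(\alpha)=\begin{pmatrix}\bar\alpha&\rho\\ \rho&-\alpha\end{pmatrix}$. For $\{\alpha_j\}_{j=0}^\infty\subset\mathbb{D}$ write $\Theta_j=\Theta(\alpha_j)$, $\mathcal{L}=\Theta_0\oplus\Theta_2\oplus\Theta_4\oplus\cdots$, $\mathcal{M}=\mathbf{1}\oplus\Theta_1\oplus\Theta_3\oplus\cdots$, where $\mathbf{1}$ is the $1\times1$ identity; the CMV matrix is the unitary operator $\mathcal{C}(\alpha)=\mathcal{L}\mathcal{M}$ on $\ell^2(\{0,1,2,\dots\})$. For a two-sided sequence $\{\beta_j\}_{j=-\infty}^\infty$ in $\mathbb{D}$, with $\Theta_j=\Theta(\beta_j)$ acting on the span of $\delta_j$ and $\delta_{j+1}$ in $\ell^2(\mathbb{Z})$, put $\tilde{\mathcal{L}}=\cdots\oplus\Theta_{-2}\oplus\Theta_0\oplus\Theta_2\oplus\cdots$,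 $\tilde{\mathcal{M}}=\cdots\oplus\Theta_{-1}\oplus\Theta_1\oplus\Theta_3\oplus\cdots$; the extended CMV matrix is $\tilde{\mathcal{C}}(\beta)=\tilde{\mathcal{L}}\tilde{\mathcal{M}}$. A two-sided sequence $\{\beta_j\}_{j=-\infty}^\infty$ is a right limit point of $\alpha$ if there is a sequence $m_j\to\infty$ such that $\lim_{j\to\infty}\alpha_{m_j+\ell}=\beta_\ell$ for every $\ell=0,\pm1,\pm2,\dots$; then $\tilde{\mathcal{C}}(\beta)$ is called a right limit of $\mathcal{C}(\alpha)$. $\sigma,\sigma_{\mathrm{ess}}$ denote spectrum and essential spectrum. *)

theory Defs
  imports "HOL-Analysis.Analysis"
begin

section \<open>The Hilbert space of square-summable families\<close>

typedef 'i ell2 = "{f :: 'i \<Rightarrow> complex. (\<lambda>i. (cmod (f i))\<^sup>2) summable_on UNIV}"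
  morphisms ell2_coord Abs_ell2
  by (rule exI[of _ "\<lambda>_. 0"]) simp

setup_lifting type_definition_ell2

lemma ell2_eqI: "(\<And>i. ell2_coord u i = ell2_coord v i) \<Longrightarrow> u = v"
  by transfer auto

lemma ell2_coord_summable: "(\<lambda>i. (cmod (ell2_coord u i))\<^sup>2) summable_on UNIV"
  using ell2_coord[of u] by simp

lemma cmod_add_sq_le: "(cmod (a + b))\<^sup>2 \<le> 2 * (cmod a)\<^sup>2 + 2 * (cmod b)\<^sup>2"
proof -
  have "(cmod (a + b))\<^sup>2 \<le> (cmod a + cmod b)\<^sup>2"
    by (simp add: norm_triangle_ineq)
  also have "\<dots> \<le> 2 * (cmod a)\<^sup>2 + 2 * (cmod b)\<^sup>2"
    using sum_squares_bound[of "cmod a" "cmod b"] by (simp add: power2_sum)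
  finally show ?thesis .
qed

instantiation ell2 :: (type) real_vector
begin

lift_definition zero_ell2 :: "'a ell2" is "\<lambda>_. 0"
  by simp

lift_definition plus_ell2 :: "'a ell2 \<Rightarrow> 'a ell2 \<Rightarrow> 'a ell2" is "\<lambda>f g i. f i + g i"
proof -
  fix f g :: "'a \<Rightarrow> complex"
  assume f: "(\<lambda>i. (cmod (f i))\<^sup>2) summable_on UNIV" and g: "(\<lambda>i. (cmod (g i))\<^sup>2) summable_on UNIV"
  show "(\<lambda>i. (cmod (f i + g i))\<^sup>2) summable_on UNIV"
    by (rule summable_on_comparison_test[OF summable_on_add[OF
          summable_on_cmult_right[OF f, of 2] summable_on_cmult_right[OF g, of 2]]])
       (auto simp: cmod_add_sq_le)
qed

lift_definition uminus_ell2 :: "'a ell2 \<Rightarrow> 'a ell2" is "\<lambda>f i. - f i"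
  by simp

definition minus_ell2 :: "'a ell2 \<Rightarrow> 'a ell2 \<Rightarrow> 'a ell2" where
  "minus_ell2 u v = u + - v"

lift_definition scaleR_ell2 :: "real \<Rightarrow> 'a ell2 \<Rightarrow> 'a ell2" is "\<lambda>r f i. r *\<^sub>R f i"
  by (auto simp: power_mult_distrib intro: summable_on_cmult_right)

instance
  by standard
     (unfold minus_ell2_def, (transfer; auto simp: algebra_simps)+)

end

lift_definition scaleC :: "complex \<Rightarrow> 'i ell2 \<Rightarrow> 'i ell2" (infixr \<open>*\<^sub>C\<close> 75)
  is "\<lambda>z f i. z * f i"
  by (auto simp: norm_mult power_mult_distrib intro: summable_on_cmult_right)

lemma ell2_coord_simps [simp]:
  "ell2_coord 0 i = 0"
  "ell2_coord (u + v) i = ell2_coord u i + ell2_coord v i"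
  "ell2_coord (- u) i = - ell2_coord u i"
  "ell2_coord (u - v) i = ell2_coord u i - ell2_coord v i"
  "ell2_coord (r *\<^sub>R u) i = r *\<^sub>R ell2_coord u i"
  "ell2_coord (z *\<^sub>C u) i = z * ell2_coord u i"
  unfolding minus_ell2_def by (transfer, simp)+

lemma ell2_inner_summable: "(\<lambda>i. ell2_coord u i \<bullet> ell2_coord v i) summable_on UNIV"
proof (rule abs_summable_summable, rule summable_on_comparison_test[OF summable_on_add[OF
          ell2_coord_summable[of u] ell2_coord_summable[of v]]])
  fix i
  have "norm (ell2_coord u i \<bullet> ell2_coord v i) \<le> cmod (ell2_coord u i) * cmod (ell2_coord v i)"
    by (simp add: Cauchy_Schwarz_ineq2)
  also have "\<dots> \<le> (cmod (ell2_coord u i))\<^sup>2 + (cmod (ell2_coord v i))\<^sup>2"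
    using sum_squares_bound[of "cmod (ell2_coord u i)" "cmod (ell2_coord v i)"]
      mult_nonneg_nonneg[of "cmod (ell2_coord u i)" "cmod (ell2_coord v i)"]
      norm_ge_zero[of "ell2_coord u i"] norm_ge_zero[of "ell2_coord v i"]
    by linarith
  finally show "norm (ell2_coord u i \<bullet> ell2_coord v i)
      \<le> (cmod (ell2_coord u i))\<^sup>2 + (cmod (ell2_coord v i))\<^sup>2" .
qed auto

text \<open>
  The library has no class of complex inner product spaces. The real inner product below is the
  real part of the usual Hermitian one, so it gives the usual norm and topology.
\<close>

instantiation ell2 :: (type) real_inner
begin

definition inner_ell2 :: "'a ell2 \<Rightarrow> 'a ell2 \<Rightarrow> real" where
  "inner_ell2 u v = (\<Sum>\<^sub>\<infinity>i. ell2_coord u i \<bullet> ell2_coord v i)"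

definition norm_ell2 :: "'a ell2 \<Rightarrow> real" where
  "norm_ell2 u = sqrt (\<Sum>\<^sub>\<infinity>i. (cmod (ell2_coord u i))\<^sup>2)"

definition sgn_ell2 :: "'a ell2 \<Rightarrow> 'a ell2" where
  "sgn_ell2 u = u /\<^sub>R norm u"

definition dist_ell2 :: "'a ell2 \<Rightarrow> 'a ell2 \<Rightarrow> real" where
  "dist_ell2 u v = norm (u - v)"

definition uniformity_ell2 :: "('a ell2 \<times> 'a ell2) filter" where
  "uniformity_ell2 = (INF e\<in>{0<..}. principal {(x, y). dist x y < e})"

definition open_ell2 :: "'a ell2 set \<Rightarrow> bool" where
  "open_ell2 U = (\<forall>x\<in>U. eventually (\<lambda>(x', y). x' = x \<longrightarrow> y \<in> U) uniformity)"

instance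
proof
  fix u v w :: "'a ell2" and r :: real
  show "sgn u = u /\<^sub>R norm u" by (rule sgn_ell2_def)
  show "dist u v = norm (u - v)" by (rule dist_ell2_def)
  show "inner u v = inner v u"
    by (simp add: inner_ell2_def inner_commute)
  show "inner (u + v) w = inner u w + inner v w"
    by (simp add: inner_ell2_def inner_add_left infsum_add ell2_inner_summable)
  show "inner (r *\<^sub>R u) v = r * inner u v"
    by (simp add: inner_ell2_def infsum_cmult_right')
  show "0 \<le> inner u u"
    by (simp add: inner_ell2_def infsum_nonneg)
  show "inner u u = 0 \<longleftrightarrow> u = 0"
  proof
    assume *: "inner u u = 0"
    have "ell2_coord u i \<bullet> ell2_coord u i = 0" for i
      by (rule nonneg_infsum_le_0D[where A = UNIV and f = "\<lambda>i. ell2_coord u i \<bullet> ell2_coord u i"])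
         (use * in \<open>auto simp: inner_ell2_def ell2_inner_summable\<close>)
    then show "u = 0"
      by (intro ell2_eqI) simp
  qed (simp add: inner_ell2_def)
  show "norm u = sqrt (inner u u)"
    by (simp add: norm_ell2_def inner_ell2_def dot_square_norm)
qed (fact uniformity_ell2_def open_ell2_def)+

end

global_interpretation ell2: vector_space "scaleC :: complex \<Rightarrow> 'i ell2 \<Rightarrow> 'i ell2"
  by standard (auto intro!: ell2_eqI simp: algebra_simps)


section \<open>Spectrum and essential spectrum of bounded operators on $\ell^2$\<close>

definition bounded_clinear :: "('i ell2 \<Rightarrow> 'j ell2) \<Rightarrow> bool" where
  "bounded_clinear T \<longleftrightarrow> bounded_linear T \<and> (\<forall>z u. T (z *\<^sub>C u) = z *\<^sub>C T u)"

definition spectrum :: "('i ell2 \<Rightarrow> 'i ell2) \<Rightarrow> complex set" where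
  "spectrum T = {z. \<not> (\<exists>S. bounded_clinear S \<and>
     (\<forall>u. S (T u - z *\<^sub>C u) = u) \<and> (\<forall>u. T (S u) - z *\<^sub>C S u = u))}"

text \<open>
  Finite-dimensional kernel, closed range, range of finite codimension; \<open>ell2.span\<close> is the
  complex linear span.
\<close>

definition fredholm :: "('i ell2 \<Rightarrow> 'j ell2) \<Rightarrow> bool" where
  "fredholm T \<longleftrightarrow>
     (\<exists>B. finite B \<and> {u. T u = 0} \<subseteq> ell2.span B) \<and>
     closed (range T) \<and>
     (\<exists>B. finite B \<and> ell2.span (range T \<union> B) = UNIV)"

definition essential_spectrum :: "('i ell2 \<Rightarrow> 'i ell2) \<Rightarrow> complex set" where
  "essential_spectrum T = {z. \<not> fredholm (\<lambda>u. T u - z *\<^sub>C u)}"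


section \<open>CMV matrices\<close>

definition Theta :: "complex \<Rightarrow> complex^2^2" where
  "Theta a = (let \<rho> = complex_of_real (sqrt (1 - (cmod a)\<^sup>2)) in
     vector [vector [cnj a, \<rho>], vector [\<rho>, - a]])"

text \<open>
  If \<open>P\<close> alternates between consecutive indices, \<open>Theta_sum P a\<close> is the direct sum over all \<open>j\<close>
  with \<open>P j\<close> of the blocks \<open>Theta (a j)\<close>, each acting on the span of the \<open>j\<close>-th and
  \<open>(j + 1)\<close>-st unit vectors: an index \<open>n\<close> is the first one of block \<open>n\<close> if \<open>P n\<close>, and otherwise the
  second one of block \<open>n - 1\<close>.
\<close>

definition Theta_sum ::
    "('i::{plus,minus,one} \<Rightarrow> bool) \<Rightarrow> ('i \<Rightarrow> complex) \<Rightarrow> ('i \<Rightarrow> complex) \<Rightarrow> 'i \<Rightarrow> complex" where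
  "Theta_sum P a f n =
     (if P n then (Theta (a n) *v vector [f n, f (n + 1)]) $ 1
      else (Theta (a (n - 1)) *v vector [f (n - 1), f n]) $ 2)"

text \<open>
  \<open>Abs_ell2\<close> is applied to square-summable families below as soon as the coefficients lie in the
  closed unit disc; see the lemmas \<open>ell2_coord_CMV_L\<close> to \<open>ell2_coord_ext_CMV_M\<close>.
\<close>

definition CMV_L :: "(nat \<Rightarrow> complex) \<Rightarrow> nat ell2 \<Rightarrow> nat ell2" where
  "CMV_L \<alpha> u = Abs_ell2 (Theta_sum even \<alpha> (ell2_coord u))"

definition CMV_M :: "(nat \<Rightarrow> complex) \<Rightarrow> nat ell2 \<Rightarrow> nat ell2" where
  "CMV_M \<alpha> u = Abs_ell2 (\<lambda>n. if n = 0 then ell2_coord u 0 else Theta_sum odd \<alpha> (ell2_coord u) n)"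

definition CMV :: "(nat \<Rightarrow> complex) \<Rightarrow> nat ell2 \<Rightarrow> nat ell2" where
  "CMV \<alpha> = CMV_L \<alpha> \<circ> CMV_M \<alpha>"

definition ext_CMV_L :: "(int \<Rightarrow> complex) \<Rightarrow> int ell2 \<Rightarrow> int ell2" where
  "ext_CMV_L \<beta> u = Abs_ell2 (Theta_sum even \<beta> (ell2_coord u))"

definition ext_CMV_M :: "(int \<Rightarrow> complex) \<Rightarrow> int ell2 \<Rightarrow> int ell2" where
  "ext_CMV_M \<beta> u = Abs_ell2 (Theta_sum odd \<beta> (ell2_coord u))"

definition ext_CMV :: "(int \<Rightarrow> complex) \<Rightarrow> int ell2 \<Rightarrow> int ell2" where
  "ext_CMV \<beta> = ext_CMV_L \<beta> \<circ> ext_CMV_M \<beta>"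

lemma Theta_mult_vec:
  "(Theta a *v vector [x, y]) $ 1 = cnj a * x + complex_of_real (sqrt (1 - (cmod a)\<^sup>2)) * y"
  "(Theta a *v vector [x, y]) $ 2 = complex_of_real (sqrt (1 - (cmod a)\<^sup>2)) * x - a * y"
  by (simp_all add: Theta_def Let_def matrix_vector_mult_def sum_2)

lemma Theta_mult_vec_bound:
  assumes "cmod a \<le> 1"
  shows "(cmod ((Theta a *v vector [x, y]) $ i))\<^sup>2 \<le> 2 * (cmod x)\<^sup>2 + 2 * (cmod y)\<^sup>2"
proof -
  define r where "r = complex_of_real (sqrt (1 - (cmod a)\<^sup>2))"
  have a2: "(cmod a)\<^sup>2 \<le> 1"
    using assms by (simp add: power_le_one)
  then have r: "cmod r \<le> 1"
    by (simp add: r_def)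
  have *: "(cmod (p * x + q * y))\<^sup>2 \<le> 2 * (cmod x)\<^sup>2 + 2 * (cmod y)\<^sup>2"
    if "cmod p \<le> 1" "cmod q \<le> 1" for p q
  proof -
    have "cmod (p * x) \<le> cmod x" "cmod (q * y) \<le> cmod y"
      using that by (simp_all add: norm_mult mult_left_le_one_le)
    then have "(cmod (p * x))\<^sup>2 \<le> (cmod x)\<^sup>2" "(cmod (q * y))\<^sup>2 \<le> (cmod y)\<^sup>2"
      by (simp_all add: power_mono)
    then show ?thesis
      using cmod_add_sq_le[of "p * x" "q * y"] by linarith
  qed
  show ?thesis
    using exhaust_2[of i] *[of "cnj a" r] *[of r "- a"] assms r
    by (auto simp: Theta_mult_vec r_def)
qed

lemma Theta_sum_bound:
  assumes "\<And>j. cmod (a j) \<le> 1"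
  shows "(cmod (Theta_sum P a f n))\<^sup>2 \<le>
    2 * (cmod (f n))\<^sup>2 + (if P n then 2 * (cmod (f (n + 1)))\<^sup>2 else 2 * (cmod (f (n - 1)))\<^sup>2)"
  using Theta_mult_vec_bound[OF assms[of n], of "f n" "f (n + 1)" 1]
    Theta_mult_vec_bound[OF assms[of "n - 1"], of "f (n - 1)" "f n" 2]
  by (auto simp: Theta_sum_def)

lemma Theta_sum_summable_int:
  fixes u :: "int ell2"
  assumes "\<And>j. cmod (a j) \<le> 1"
  shows "(\<lambda>n. (cmod (Theta_sum P a (ell2_coord u) n))\<^sup>2) summable_on UNIV"
proof -
  let ?f = "\<lambda>n. (cmod (ell2_coord u n))\<^sup>2"
  have p: "(\<lambda>n. ?f (n + 1)) summable_on UNIV" and m: "(\<lambda>n. ?f (n - 1)) summable_on UNIV"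
    using ell2_coord_summable[of u]
      summable_on_reindex_bij_witness[of UNIV "\<lambda>n. n - 1" "\<lambda>n. n + 1" UNIV ?f "\<lambda>n. ?f (n + 1)"]
      summable_on_reindex_bij_witness[of UNIV "\<lambda>n. n + 1" "\<lambda>n. n - 1" UNIV ?f "\<lambda>n. ?f (n - 1)"]
    by auto
  have "(\<lambda>n. 2 * ?f n + (2 * ?f (n + 1) + 2 * ?f (n - 1))) summable_on UNIV"
    by (intro summable_on_add summable_on_cmult_right p m ell2_coord_summable)
  then show ?thesis
  proof (rule summable_on_comparison_test)
    fix n :: int
    show "(cmod (Theta_sum P a (ell2_coord u) n))\<^sup>2 \<le> 2 * ?f n + (2 * ?f (n + 1) + 2 * ?f (n - 1))"
      by (rule order_trans[OF Theta_sum_bound[OF assms]]) auto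
  qed auto
qed

lemma Theta_sum_summable_nat:
  fixes u :: "nat ell2"
  assumes "\<And>j. cmod (a j) \<le> 1"
  shows "(\<lambda>n. (cmod (Theta_sum P a (ell2_coord u) n))\<^sup>2) summable_on UNIV"
proof -
  let ?f = "\<lambda>n. (cmod (ell2_coord u n))\<^sup>2"
  have s: "summable ?f"
    using ell2_coord_summable[of u] by (simp add: summable_on_UNIV_nonneg_real_iff)
  have p: "summable (\<lambda>n. ?f (n + 1))" and m: "summable (\<lambda>n. ?f (n - 1))"
    using s summable_Suc_iff[of "\<lambda>n. ?f (n - 1)"] summable_Suc_iff[of ?f] by auto
  have "summable (\<lambda>n. 2 * ?f n + (2 * ?f (n + 1) + 2 * ?f (n - 1)))"
    by (intro summable_add summable_mult p m s)
  then have "(\<lambda>n. 2 * ?f n + (2 * ?f (n + 1) + 2 * ?f (n - 1))) summable_on UNIV"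
    by (subst summable_on_UNIV_nonneg_real_iff) auto
  then show ?thesis
  proof (rule summable_on_comparison_test)
    fix n :: nat
    show "(cmod (Theta_sum P a (ell2_coord u) n))\<^sup>2 \<le> 2 * ?f n + (2 * ?f (n + 1) + 2 * ?f (n - 1))"
      by (rule order_trans[OF Theta_sum_bound[OF assms]]) auto
  qed auto
qed

lemma ell2_coord_CMV_L:
  assumes "\<And>j. cmod (\<alpha> j) \<le> 1"
  shows "ell2_coord (CMV_L \<alpha> u) = Theta_sum even \<alpha> (ell2_coord u)"
  unfolding CMV_L_def by (rule Abs_ell2_inverse) (simp add: Theta_sum_summable_nat assms)

lemma ell2_coord_CMV_M:
  assumes "\<And>j. cmod (\<alpha> j) \<le> 1"
  shows "ell2_coord (CMV_M \<alpha> u) =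
    (\<lambda>n. if n = 0 then ell2_coord u 0 else Theta_sum odd \<alpha> (ell2_coord u) n)"
  unfolding CMV_M_def
proof (rule Abs_ell2_inverse, simp)
  let ?g = "\<lambda>n. (cmod (if n = 0 then ell2_coord u 0 else Theta_sum odd \<alpha> (ell2_coord u) n))\<^sup>2"
  have "(\<lambda>n. (cmod (ell2_coord u n))\<^sup>2 + (cmod (Theta_sum odd \<alpha> (ell2_coord u) n))\<^sup>2) summable_on UNIV"
    by (intro summable_on_add ell2_coord_summable Theta_sum_summable_nat assms)
  then show "?g summable_on UNIV"
    by (rule summable_on_comparison_test) auto
qed

lemma ell2_coord_ext_CMV_L:
  assumes "\<And>j. cmod (\<beta> j) \<le> 1"
  shows "ell2_coord (ext_CMV_L \<beta> u) = Theta_sum even \<beta> (ell2_coord u)"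
  unfolding ext_CMV_L_def by (rule Abs_ell2_inverse) (simp add: Theta_sum_summable_int assms)

lemma ell2_coord_ext_CMV_M:
  assumes "\<And>j. cmod (\<beta> j) \<le> 1"
  shows "ell2_coord (ext_CMV_M \<beta> u) = Theta_sum odd \<beta> (ell2_coord u)"
  unfolding ext_CMV_M_def by (rule Abs_ell2_inverse) (simp add: Theta_sum_summable_int assms)


section \<open>Right limits\<close>

text \<open>
  The truncation in \<open>nat\<close> only affects the finitely many \<open>j\<close> with \<open>m j + l < 0\<close>.
\<close>

definition right_limit_point :: "(nat \<Rightarrow> complex) \<Rightarrow> (int \<Rightarrow> complex) \<Rightarrow> bool" where
  "right_limit_point \<alpha> \<beta> \<longleftrightarrow>
     (\<exists>m :: nat \<Rightarrow> nat. filterlim m at_top sequentially \<and>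
        (\<forall>l. (\<lambda>j. \<alpha> (nat (int (m j) + l))) \<longlonglongrightarrow> \<beta> l))"

definition right_limits :: "(nat \<Rightarrow> complex) \<Rightarrow> (int ell2 \<Rightarrow> int ell2) set" where
  "right_limits \<alpha> = {ext_CMV \<beta> |\<beta>. right_limit_point \<alpha> \<beta>}"

end

theory Submission
  imports Defs "HOL-Complex_Analysis.Great_Picard"
begin

text \<open>
  Both inclusions go through escaping approximate eigenvectors: for every \<open>e > 0\<close>, finitely supported
  \<open>u \<noteq> 0\<close> arbitrarily far to the right with \<open>\<parallel>(C - z) u\<parallel> \<le> e \<parallel>u\<parallel>\<close>. If there are none, \<open>C - z\<close> is bounded
  below on a subspace of finite codimension and hence Fredholm, as it is normal. If there are some,
  choose them with disjoint supports; the series formed from infinitely many disjoint subfamilies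
  show that the range has infinite codimension.

  Approximate eigenvectors of a right limit can be truncated and translated far to the right.
  Conversely, multiplying \<open>L M - z\<close> by the inverse of \<open>L\<close> gives a tridiagonal operator of the same norm,
  so cutting escaping vectors with sharp windows of a fixed length and averaging over the position
  of the window yields approximate eigenvectors whose support has bounded length. By compactness
  they converge, after translation, to approximate eigenvectors of a right limit; as that operator is
  unitary, its spectrum comes close to \<open>z\<close>.
\<close>


section \<open>The Hilbert space of square-summable families\<close>

text \<open>The right limit extracted by compactness depends on the accuracy \<open>e\<close>, so no
  single limit operator inherits a whole sequence of approximate eigenvectors. What survives is one
  vector of accuracy \<open>e\<close> for some right limit. For a unitary operator this already puts
  a spectral point within \<open>e\<close> of \<open>z\<close>, and letting \<open>e\<close> tend to
  0 gives a point of the closure.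

  Sharp windows suffice because a tridiagonal operator notices a cut at no more than four indices.
  Over all positions of a window of length \<open>L\<close> the cutting errors add up to a constant
  multiple of the squared norm, whereas the main terms carry the factor \<open>L\<close>.

  Translation by an odd integer exchanges the two factors of the CMV matrix. Hence the block
  operators are studied for a general alternating parity predicate, and the half-line operator is
  embedded in one on the integers, where translations act.

  The inner product is only the real part of the Hermitian one. Orthogonality to a complex subspace
  is unaffected, but test vectors must carry the scalar that makes the pairing real.\<close>

lemma norm_ell2_power2: "(norm u)\<^sup>2 = (\<Sum>\<^sub>\<infinity>i. (cmod (ell2_coord u i))\<^sup>2)"
  by (simp add: norm_ell2_def infsum_nonneg)

lemma sum_coord_le_norm:
  assumes "finite F"
  shows "(\<Sum>i\<in>F. (cmod (ell2_coord u i))\<^sup>2) \<le> (norm u)\<^sup>2"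
  unfolding norm_ell2_power2
  by (rule finite_sum_le_infsum) (use assms in \<open>auto simp: ell2_coord_summable\<close>)

lemma norm_ell2_finite_support:
  assumes "finite F" "\<And>i. i \<notin> F \<Longrightarrow> ell2_coord u i = 0"
  shows "(norm u)\<^sup>2 = (\<Sum>i\<in>F. (cmod (ell2_coord u i))\<^sup>2)"
proof -
  have "(\<Sum>\<^sub>\<infinity>i\<in>UNIV. (cmod (ell2_coord u i))\<^sup>2) = (\<Sum>\<^sub>\<infinity>i\<in>F. (cmod (ell2_coord u i))\<^sup>2)"
    by (rule infsum_cong_neutral) (use assms in auto)
  then show ?thesis
    using assms by (simp add: norm_ell2_power2)
qed

lemma cmod_coord_le_norm: "cmod (ell2_coord u i) \<le> norm u"
  using sum_coord_le_norm[of "{i}" u] by (simp add: power2_le_iff_abs_le)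

lemma norm_scaleC: "norm (z *\<^sub>C u) = cmod z * norm u"
proof -
  have "(norm (z *\<^sub>C u))\<^sup>2 = (cmod z * norm u)\<^sup>2"
    by (simp add: norm_ell2_power2 power_mult_distrib norm_mult infsum_cmult_right')
  then show ?thesis
    by (simp add: power2_eq_iff_nonneg)
qed

lemma scaleR_scaleC: "r *\<^sub>R u = complex_of_real r *\<^sub>C u"
  by (intro ell2_eqI) (simp add: scaleR_conv_of_real)

lemma inner_scaleC_left: "inner (z *\<^sub>C u) v = inner u (cnj z *\<^sub>C v)"
  unfolding inner_ell2_def by (simp add: inner_complex_def algebra_simps)

lift_definition cut :: "'i set \<Rightarrow> 'i ell2 \<Rightarrow> 'i ell2" is "\<lambda>F f i. if i \<in> F then f i else 0"
proof -
  fix F and f :: "'i \<Rightarrow> complex"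
  assume "(\<lambda>i. (cmod (f i))\<^sup>2) summable_on UNIV"
  then show "(\<lambda>i. (cmod (if i \<in> F then f i else 0))\<^sup>2) summable_on UNIV"
    by (rule summable_on_comparison_test) auto
qed

lemma coord_cut [simp]: "ell2_coord (cut F u) i = (if i \<in> F then ell2_coord u i else 0)"
  by transfer simp

lemma cut_approx:
  assumes "e > 0"
  obtains F where "finite F" "norm (u - cut F u) < e"
proof -
  let ?f = "\<lambda>i. (cmod (ell2_coord u i))\<^sup>2"
  obtain F where F: "finite F" "dist (sum ?f F) (infsum ?f UNIV) \<le> e\<^sup>2 / 2"
    using infsum_finite_approximation[OF ell2_coord_summable[of u], of "e\<^sup>2 / 2"] assms by auto
  have "infsum ?f UNIV = infsum ?f F + infsum ?f (- F)"
    by (subst infsum_Un_disjoint[symmetric])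
       (auto intro: summable_on_subset_banach[OF ell2_coord_summable[of u]])
  moreover have "(norm (u - cut F u))\<^sup>2 = infsum ?f (- F)"
    unfolding norm_ell2_power2 by (rule infsum_cong_neutral) auto
  ultimately have "(norm (u - cut F u))\<^sup>2 \<le> e\<^sup>2 / 2"
    using F by (simp add: dist_real_def)
  then have "(norm (u - cut F u))\<^sup>2 < e\<^sup>2"
    using assms zero_less_power[of e 2] by linarith
  then have "norm (u - cut F u) < e"
    using assms by (simp add: power2_less_imp_less)
  then show ?thesis
    using F that by blast
qed

text \<open>The limit is taken coordinatewise. Passing to the limit in finite partial sums of
  \<open>X n - X m\<close> yields both square-summability of the difference to the limit and the
  norm estimate.\<close>

lemma convergent_ell2_if_Cauchy:
  fixes X :: "nat \<Rightarrow> 'i ell2"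
  assumes "Cauchy X"
  shows "convergent X"
proof -
  have "Cauchy (\<lambda>n. ell2_coord (X n) i)" for i
  proof (rule metric_CauchyI)
    fix e :: real assume "e > 0"
    then obtain M where M: "\<And>m n. m \<ge> M \<Longrightarrow> n \<ge> M \<Longrightarrow> dist (X m) (X n) < e"
      using assms metric_CauchyD by blast
    have "dist (ell2_coord (X m) i) (ell2_coord (X n) i) < e" if "m \<ge> M" "n \<ge> M" for m n
      using M[OF that] cmod_coord_le_norm[of "X m - X n" i] by (simp add: dist_norm)
    then show "\<exists>M. \<forall>m\<ge>M. \<forall>n\<ge>M. dist (ell2_coord (X m) i) (ell2_coord (X n) i) < e"
      by blast
  qed
  then have "\<forall>i. \<exists>l. (\<lambda>n. ell2_coord (X n) i) \<longlonglongrightarrow> l"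
    using Cauchy_convergent convergent_def by blast
  then obtain f where f: "\<And>i. (\<lambda>n. ell2_coord (X n) i) \<longlonglongrightarrow> f i"
    by metis
  have fin: "(\<Sum>i\<in>F. (cmod (ell2_coord (X n) i - f i))\<^sup>2) \<le> e\<^sup>2"
    if "finite F" "\<And>m. m \<ge> n \<Longrightarrow> norm (X n - X m) \<le> e" for F n e
  proof (rule LIMSEQ_le_const2)
    show "(\<lambda>m. \<Sum>i\<in>F. (cmod (ell2_coord (X n) i - ell2_coord (X m) i))\<^sup>2) \<longlonglongrightarrow>
        (\<Sum>i\<in>F. (cmod (ell2_coord (X n) i - f i))\<^sup>2)"
      by (intro tendsto_intros f)
    have "(\<Sum>i\<in>F. (cmod (ell2_coord (X n) i - ell2_coord (X m) i))\<^sup>2) \<le> e\<^sup>2" if "m \<ge> n" for m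
      using sum_coord_le_norm[OF \<open>finite F\<close>, of "X n - X m"]
        power_mono[OF \<open>\<And>m. m \<ge> n \<Longrightarrow> norm (X n - X m) \<le> e\<close>[OF that], of 2]
      by simp
    then show "\<exists>N. \<forall>m\<ge>N. (\<Sum>i\<in>F. (cmod (ell2_coord (X n) i - ell2_coord (X m) i))\<^sup>2) \<le> e\<^sup>2"
      by blast
  qed
  have sm: "(\<lambda>i. (cmod (ell2_coord (X n) i - f i))\<^sup>2) summable_on UNIV \<and>
      (\<Sum>\<^sub>\<infinity>i. (cmod (ell2_coord (X n) i - f i))\<^sup>2) \<le> e\<^sup>2"
    if "\<And>m. m \<ge> n \<Longrightarrow> norm (X n - X m) \<le> e" for n e
  proof
    show "(\<lambda>i. (cmod (ell2_coord (X n) i - f i))\<^sup>2) summable_on UNIV"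
      by (rule nonneg_bdd_above_summable_on) (use fin[OF _ that] in \<open>auto intro!: bdd_aboveI\<close>)
    then show "(\<Sum>\<^sub>\<infinity>i. (cmod (ell2_coord (X n) i - f i))\<^sup>2) \<le> e\<^sup>2"
      by (rule infsum_le_finite_sums) (use fin[OF _ that] in auto)
  qed
  have ev: "\<exists>N. \<forall>n\<ge>N. \<forall>m\<ge>n. norm (X n - X m) \<le> e" if e: "e > 0" for e
  proof -
    obtain N where "\<And>m n. m \<ge> N \<Longrightarrow> n \<ge> N \<Longrightarrow> dist (X m) (X n) < e"
      using metric_CauchyD[OF assms e] by blast
    then have "\<forall>n\<ge>N. \<forall>m\<ge>n. norm (X n - X m) \<le> e"
      by (simp add: dist_norm less_imp_le)
    then show ?thesis
      by blast
  qed
  obtain N where "\<forall>n\<ge>N. \<forall>m\<ge>n. norm (X n - X m) \<le> 1"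
    using ev[of 1] by auto
  then have s: "(\<lambda>i. (cmod (ell2_coord (X N) i - f i))\<^sup>2) summable_on UNIV"
    using sm[of N 1] by auto
  \<comment> \<open>Only the difference between \<open>X N\<close> and the coordinatewise limit is
    known to be square-summable, so the limit is recovered as \<open>X N - w\<close>.\<close>
  define w where "w = Abs_ell2 (\<lambda>i. ell2_coord (X N) i - f i)"
  have w: "ell2_coord w i = ell2_coord (X N) i - f i" for i
    unfolding w_def by (subst Abs_ell2_inverse) (use s in auto)
  define L where "L = X N - w"
  have L: "ell2_coord L i = f i" for i
    by (simp add: L_def w)
  have "X \<longlonglongrightarrow> L"
  proof (rule metric_LIMSEQ_I)
    fix e :: real assume "e > 0"
    then obtain N where N: "\<forall>n\<ge>N. \<forall>m\<ge>n. norm (X n - X m) \<le> e / 2"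
      using ev[of "e / 2"] by auto
    have "dist (X n) L < e" if "n \<ge> N" for n
    proof -
      have "(norm (X n - L))\<^sup>2 \<le> (e / 2)\<^sup>2"
        using sm[of n "e / 2"] N that by (simp add: norm_ell2_power2 L)
      then have "norm (X n - L) \<le> e / 2"
        using \<open>e > 0\<close> by (simp add: power2_le_iff_abs_le)
      then show ?thesis
        using \<open>e > 0\<close> by (simp add: dist_norm)
    qed
    then show "\<exists>N. \<forall>n\<ge>N. dist (X n) L < e"
      by blast
  qed
  then show ?thesis
    by (auto simp: convergent_def)
qed

instance ell2 :: (type) banach
  by standard (rule convergent_ell2_if_Cauchy)

section \<open>Orthogonal projection onto closed subspaces\<close>

text \<open>A minimising sequence for the distance is Cauchy by the parallelogram law, since
  midpoints stay in \<open>S\<close> and so are at distance at least \<open>d\<close> from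
  \<open>f\<close>; its limit is the foot of the perpendicular.\<close>

lemma exists_orthogonal_projection:
  fixes f :: "'a::{real_inner, complete_space}"
  assumes S: "subspace S" "closed S"
  obtains p where "p \<in> S" "\<And>s. s \<in> S \<Longrightarrow> inner (f - p) s = 0"
proof -
  define d where "d = infdist f S"
  have ne: "S \<noteq> {}" and S0: "0 \<in> S"
    using S subspace_0 by auto
  have "\<exists>s\<in>S. dist f s < d + inverse (real (Suc n))" for n
  proof -
    have "(INF s\<in>S. dist f s) < d + inverse (real (Suc n))"
      using ne infdist_notempty[of S f] by (simp add: d_def)
    then show ?thesis
      using cInf_lessD[of "dist f ` S" "d + inverse (real (Suc n))"] ne by blast
  qed
  then obtain s where s: "\<And>n. s n \<in> S" and sd: "\<And>n. dist f (s n) < d + inverse (real (Suc n))"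
    by metis
  have d0: "d \<ge> 0"
    by (simp add: d_def infdist_nonneg)
  have dle: "d \<le> norm (f - y)" if "y \<in> S" for y
    using infdist_le[OF that, of f] by (simp add: d_def dist_norm)
  have par: "(norm (a - b))\<^sup>2 \<le> 2 * (norm (f - a))\<^sup>2 + 2 * (norm (f - b))\<^sup>2 - 4 * d\<^sup>2"
    if "a \<in> S" "b \<in> S" for a b
  proof -
    have "(1 / 2) *\<^sub>R (a + b) \<in> S"
      using S that by (simp add: subspace_add subspace_scale)
    then have "d\<^sup>2 \<le> (norm (f - (1 / 2) *\<^sub>R (a + b)))\<^sup>2"
      using dle d0 by (simp add: power_mono)
    also have "norm (f - (1 / 2) *\<^sub>R (a + b)) = norm ((f - a) + (f - b)) / 2"
    proof -
      have "f - (1 / 2) *\<^sub>R (a + b) = (1 / 2) *\<^sub>R ((f - a) + (f - b))"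
        by (simp add: scaleR_right_distrib scaleR_right_diff_distrib flip: scaleR_add_left)
      then show ?thesis
        by simp
    qed
    finally have "4 * d\<^sup>2 \<le> (norm ((f - a) + (f - b)))\<^sup>2"
      by (simp add: power_divide)
    moreover have "norm (a - b) = norm ((f - a) - (f - b))"
      by (simp add: norm_minus_commute)
    moreover have pl: "(norm (x - y))\<^sup>2 = 2 * (norm x)\<^sup>2 + 2 * (norm y)\<^sup>2 - (norm (x + y))\<^sup>2" for x y :: 'a
      by (simp add: power2_norm_eq_inner inner_diff_left inner_diff_right inner_add_left
          inner_add_right inner_commute)
    ultimately show ?thesis
      using pl[of "f - a" "f - b"] by simp
  qed
  have "(\<lambda>n. d + inverse (real (Suc n))) \<longlonglongrightarrow> d + 0"
    by (intro tendsto_intros LIMSEQ_inverse_real_of_nat)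
  then have lim: "(\<lambda>n. d + inverse (real (Suc n))) \<longlonglongrightarrow> d"
    by simp
  have nd: "(\<lambda>n. norm (f - s n)) \<longlonglongrightarrow> d"
  proof (rule tendsto_sandwich[OF _ _ tendsto_const lim])
    show "\<forall>\<^sub>F n in sequentially. d \<le> norm (f - s n)"
      by (intro always_eventually allI dle s)
    show "\<forall>\<^sub>F n in sequentially. norm (f - s n) \<le> d + inverse (real (Suc n))"
      using less_imp_le[OF sd] unfolding dist_norm by (intro always_eventually allI)
  qed
  have "Cauchy s"
  proof (rule metric_CauchyI)
    fix e :: real assume e: "e > 0"
    have "(\<lambda>n. 2 * (norm (f - s n))\<^sup>2 - 2 * d\<^sup>2) \<longlonglongrightarrow> 2 * d\<^sup>2 - 2 * d\<^sup>2"
      by (intro tendsto_intros nd)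
    then have "eventually (\<lambda>n. 2 * (norm (f - s n))\<^sup>2 - 2 * d\<^sup>2 < e\<^sup>2 / 2) sequentially"
      by (rule order_tendstoD) (use e in auto)
    then obtain N where N: "\<And>n. n \<ge> N \<Longrightarrow> 2 * (norm (f - s n))\<^sup>2 - 2 * d\<^sup>2 < e\<^sup>2 / 2"
      by (auto simp: eventually_sequentially)
    have "dist (s m) (s n) < e" if "m \<ge> N" "n \<ge> N" for m n
    proof -
      have "(norm (s m - s n))\<^sup>2 < e\<^sup>2"
        using par[OF s s, of m n] N[OF that(1)] N[OF that(2)] by linarith
      then show ?thesis
        using e by (simp add: dist_norm power2_less_imp_less)
    qed
    then show "\<exists>M. \<forall>m\<ge>M. \<forall>n\<ge>M. dist (s m) (s n) < e"
      by blast
  qed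
  then obtain p where p: "s \<longlonglongrightarrow> p"
    using Cauchy_convergent convergent_def by blast
  have pS: "p \<in> S"
    using closed_sequentially[OF S(2) s p] .
  have "(\<lambda>n. norm (f - s n)) \<longlonglongrightarrow> norm (f - p)"
    by (intro tendsto_intros p)
  then have pd: "norm (f - p) = d"
    using nd LIMSEQ_unique by blast
  have "inner (f - p) y = 0" if y: "y \<in> S" for y
  proof (rule ccontr)
    assume c: "inner (f - p) y \<noteq> 0"
    then have y0: "inner y y > 0"
      by (metis inner_gt_zero_iff inner_zero_right)
    \<comment> \<open>This \<open>t\<close> minimises the distance from \<open>f\<close> to
      \<open>p + t *\<^sub>R y\<close>; moving there would lower the squared distance below its
      minimum.\<close>
    define t where "t = inner (f - p) y / inner y y"
    have "p + t *\<^sub>R y \<in> S"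
      using S y pS by (simp add: subspace_add subspace_scale)
    then have "d\<^sup>2 \<le> (norm (f - (p + t *\<^sub>R y)))\<^sup>2"
      using dle d0 by (simp add: power_mono)
    also have "f - (p + t *\<^sub>R y) = (f - p) - t *\<^sub>R y"
      by simp
    also have "(norm \<dots>)\<^sup>2 = (norm (f - p))\<^sup>2 - 2 * t * inner (f - p) y + t * t * inner y y"
      unfolding power2_norm_eq_inner inner_diff_left[of "f - p"] inner_diff_right[of _ "f - p"]
      by (simp only: inner_scaleR_left inner_scaleR_right inner_commute[of y "f - p"])
    also have "\<dots> = d\<^sup>2 - (inner (f - p) y)\<^sup>2 / inner y y"
      using y0 by (simp add: pd t_def power2_eq_square)
    finally show False
      using c y0 by (simp add: field_simps)
  qed
  with pS show ?thesis
    using that by blast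
qed


section \<open>Unitary operators\<close>

lemma bounded_linear_scaleC_right: "bounded_linear (\<lambda>u. z *\<^sub>C u)"
  by (rule bounded_linear_intro[where K = "cmod z"])
     (auto intro!: ell2_eqI simp: algebra_simps norm_scaleC)

lemma bounded_linear_scaleC_left: "bounded_linear (\<lambda>z. z *\<^sub>C u)"
  by (rule bounded_linear_intro[where K = "norm u"])
     (auto intro!: ell2_eqI simp: algebra_simps norm_scaleC)

lemma bounded_linear_ell2_coord: "bounded_linear (\<lambda>u. ell2_coord u i)"
  by (rule bounded_linear_intro[where K = 1]) (auto simp: cmod_coord_le_norm)

lemma bounded_clinear_linear: "bounded_clinear T \<Longrightarrow> linear T"
  by (simp add: bounded_clinear_def bounded_linear.linear)

lemma bounded_clinear_simps:
  assumes "bounded_clinear T"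
  shows "T (u + v) = T u + T v" "T (u - v) = T u - T v" "T 0 = 0" "T (z *\<^sub>C u) = z *\<^sub>C T u"
  using bounded_clinear_linear[OF assms] assms
  by (auto simp: linear_add linear_diff linear_0 bounded_clinear_def)

lemma bounded_clinear_shift:
  assumes "bounded_clinear T"
  shows "bounded_clinear (\<lambda>u. T u - z *\<^sub>C u)"
  using assms unfolding bounded_clinear_def
  by (auto intro!: bounded_linear_sub bounded_linear_scaleC_right ell2_eqI simp: algebra_simps)

lemma clinear_subspace_image:
  assumes "bounded_clinear T" "ell2.subspace V"
  shows "ell2.subspace (T ` V)"
proof (rule ell2.subspaceI)
  show "0 \<in> T ` V"
    using bounded_clinear_simps(3)[OF assms(1)] ell2.subspace_0[OF assms(2)] by (metis imageI)
next
  fix x y assume "x \<in> T ` V" "y \<in> T ` V"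
  then obtain u v where "x = T u" "u \<in> V" "y = T v" "v \<in> V"
    by blast
  then show "x + y \<in> T ` V"
    by (auto intro!: image_eqI[of _ _ "u + v"] ell2.subspace_add[OF assms(2)]
        simp: bounded_clinear_simps(1)[OF assms(1)])
next
  fix c x assume "x \<in> T ` V"
  then obtain u where "x = T u" "u \<in> V"
    by blast
  then show "c *\<^sub>C x \<in> T ` V"
    by (auto intro!: image_eqI[of _ _ "c *\<^sub>C u"] ell2.subspace_scale[OF assms(2)]
        simp: bounded_clinear_simps(4)[OF assms(1)])
qed

lemma csubspace_imp_subspace: "ell2.subspace V \<Longrightarrow> subspace V"
  unfolding subspace_def ell2.subspace_def by (simp add: scaleR_scaleC)

section \<open>Spectrum and approximate eigenvectors\<close>

text \<open>An inverse with bound \<open>K\<close> is incompatible with an approximate eigenvector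
  of accuracy \<open>1 / (2 * K)\<close>.\<close>

lemma spectrum_if_approximate_eigenvectors:
  assumes "\<And>e. e > 0 \<Longrightarrow> \<exists>u. u \<noteq> 0 \<and> norm (T u - z *\<^sub>C u) \<le> e * norm u"
  shows "z \<in> spectrum T"
proof (rule ccontr)
  assume "z \<notin> spectrum T"
  then obtain S where S: "bounded_clinear S" "\<And>u. S (T u - z *\<^sub>C u) = u"
    unfolding spectrum_def by auto
  obtain K where K: "K > 0" "\<And>x. norm (S x) \<le> norm x * K"
    using bounded_linear.pos_bounded S(1) unfolding bounded_clinear_def by blast
  obtain u where u: "u \<noteq> 0" "norm (T u - z *\<^sub>C u) \<le> (1 / (2 * K)) * norm u"
    using assms[of "1 / (2 * K)"] K by auto
  have "norm u \<le> norm (T u - z *\<^sub>C u) * K"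
    using K(2)[of "T u - z *\<^sub>C u"] S(2) by simp
  also have "\<dots> \<le> (1 / (2 * K)) * norm u * K"
    using mult_right_mono[OF u(2), of K] K(1) by linarith
  also have "\<dots> = norm u / 2"
    using K(1) by simp
  finally show False
    using u(1) by simp
qed

text \<open>Surjective isometries, so that no adjoint has to be constructed. Its role is played by
  writing arbitrary vectors as \<open>U w\<close>.\<close>

definition unitary :: "('i ell2 \<Rightarrow> 'i ell2) \<Rightarrow> bool" where
  "unitary U \<longleftrightarrow> bounded_clinear U \<and> (\<forall>u. norm (U u) = norm u) \<and> surj U"

context
  fixes U :: "'i ell2 \<Rightarrow> 'i ell2"
  assumes U: "unitary U"
begin

lemma unitary_clinear: "bounded_clinear U"
  and unitary_norm [simp]: "norm (U u) = norm u"
  and unitary_surj: "surj U"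
  using U unfolding unitary_def by auto

lemmas unitary_simps = bounded_clinear_simps[OF unitary_clinear]

lemma unitary_inner: "inner (U u) (U v) = inner u v"
  using unitary_norm[of "u + v"] unitary_norm[of u] unitary_norm[of v]
  by (simp add: unitary_simps norm_eq_sqrt_inner inner_add_left inner_add_right inner_commute)

text \<open>Substitute for the adjoint: the adjoint of \<open>U - z\<close>, composed with
  \<open>U\<close>, is \<open>1 - cnj z U\<close>.\<close>

lemma unitary_inner_shift:
  "inner (U g - z *\<^sub>C g) (U w) = inner g (w - cnj z *\<^sub>C U w)"
  by (simp add: inner_diff_left inner_diff_right unitary_inner inner_scaleC_left)

text \<open>This is normality of \<open>U - z\<close>: the left side is the norm of the adjoint
  shift at \<open>U u\<close>, and \<open>U\<close> commutes with \<open>U - z\<close>. Both squares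
  expand to the same three terms.\<close>

lemma unitary_norm_adjoint_shift: "norm (u - cnj z *\<^sub>C U u) = norm (U u - z *\<^sub>C u)"
proof -
  have "inner (cnj z *\<^sub>C U u) u = inner (U u) (z *\<^sub>C u)"
    by (simp add: inner_scaleC_left)
  then have "(norm (u - cnj z *\<^sub>C U u))\<^sup>2 = (norm (U u - z *\<^sub>C u))\<^sup>2"
    unfolding power2_norm_eq_inner inner_diff_left inner_diff_right
    using unitary_norm[of u] norm_scaleC[of "cnj z" "U u"] norm_scaleC[of z u]
    by (simp add: inner_commute flip: power2_norm_eq_inner)
  then show ?thesis
    by simp
qed

text \<open>Cauchy-Schwarz after moving the shift to the other side, where normality replaces the
  adjoint shift by the shift itself. Thus approximate eigenvectors are almost orthogonal to the
  range of \<open>U - z\<close>.\<close>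

lemma unitary_inner_shift_le:
  "inner (U g - z *\<^sub>C g) w \<le> norm g * norm (U w - z *\<^sub>C w)"
proof -
  obtain v where v: "w = U v"
    using unitary_surj by blast
  have "inner (U g - z *\<^sub>C g) w \<le> norm g * norm (v - cnj z *\<^sub>C U v)"
    unfolding v unitary_inner_shift by (rule norm_cauchy_schwarz)
  also have "norm (v - cnj z *\<^sub>C U v) = norm (U (U v - z *\<^sub>C v))"
    by (simp add: unitary_norm_adjoint_shift)
  finally show ?thesis
    by (simp add: unitary_simps v)
qed

text \<open>A unitary shift \<open>U - z\<close> is normal, so the orthogonal complement of its range is its kernel.\<close>

lemma unitary_range_complement:
  assumes "closed (range (\<lambda>u. U u - z *\<^sub>C u))"
  obtains u w where "f = (U u - z *\<^sub>C u) + w" "U w - z *\<^sub>C w = 0"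
proof -
  let ?A = "\<lambda>u. U u - z *\<^sub>C u"
  have "subspace (range ?A)"
    by (intro csubspace_imp_subspace clinear_subspace_image bounded_clinear_shift unitary_clinear) simp
  then obtain p where p: "p \<in> range ?A" "\<And>s. s \<in> range ?A \<Longrightarrow> inner (f - p) s = 0"
    using exists_orthogonal_projection[OF _ assms] by blast
  obtain v where v: "f - p = U v"
    using unitary_surj by blast
  have "inner (U g - z *\<^sub>C g) (U v) = 0" for g
    using p(2)[of "U g - z *\<^sub>C g"] by (simp add: v inner_commute)
  then have "v - cnj z *\<^sub>C U v = 0"
    unfolding unitary_inner_shift by (metis inner_eq_zero_iff)
  then have "norm (U v - z *\<^sub>C v) = 0"
    by (simp flip: unitary_norm_adjoint_shift)
  then have "U (U v) - z *\<^sub>C U v = 0"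
    using unitary_norm[of "U v - z *\<^sub>C v"] by (simp add: unitary_simps)
  moreover obtain u where "p = U u - z *\<^sub>C u"
    using p(1) by blast
  then have "f = (U u - z *\<^sub>C u) + U v"
    by (simp flip: v)
  ultimately show ?thesis
    using that by blast
qed

text \<open>Were \<open>U - z\<close> bounded below by \<open>e\<close>, its range would be closed
  and its kernel zero. The kernel is also the orthogonal complement of the range, so the operator
  would be bijective with inverse bounded by \<open>1 / e\<close>.\<close>

lemma approximate_eigenvectors_if_spectrum:
  assumes "z \<in> spectrum U" "e > 0"
  shows "\<exists>u. u \<noteq> 0 \<and> norm (U u - z *\<^sub>C u) \<le> e * norm u"
proof (rule ccontr)
  assume "\<not> ?thesis"
  then have lb: "e * norm u \<le> norm (U u - z *\<^sub>C u)" for u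
    by (cases "u = 0") (auto simp: unitary_simps)
  let ?A = "\<lambda>u. U u - z *\<^sub>C u"
  have A: "bounded_clinear ?A"
    by (intro bounded_clinear_shift unitary_clinear)
  have "complete (range ?A)"
    by (rule complete_isometric_image[of e])
       (use assms(2) lb A in \<open>auto simp: bounded_clinear_def complete_UNIV\<close>)
  then have cl: "closed (range ?A)"
    by (rule complete_imp_closed)
  have ker: "w = 0" if "?A w = 0" for w
    using lb[of w] that assms(2) by (simp add: mult_le_0_iff)
  have "\<exists>u. ?A u = f" for f
    using unitary_range_complement[OF cl, of f] ker by (metis add.right_neutral)
  then obtain S where S: "\<And>f. ?A (S f) = f"
    by metis
  have inj: "u = v" if "?A u = ?A v" for u v
    using ker[of "u - v"] that by (simp add: bounded_clinear_simps[OF A])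
  have "bounded_linear S"
  proof (rule bounded_linear_intro[where K = "1 / e"])
    fix x y r
    show "S (x + y) = S x + S y"
      by (rule inj) (use S bounded_clinear_simps[OF A] in simp)
    show "S (r *\<^sub>R x) = r *\<^sub>R S x"
      by (rule inj) (use S bounded_clinear_simps[OF A] in \<open>simp add: scaleR_scaleC\<close>)
    show "norm (S x) \<le> norm x * (1 / e)"
      using lb[of "S x"] S[of x] assms(2) by (simp add: field_simps)
  qed
  moreover have "S (c *\<^sub>C x) = c *\<^sub>C S x" for c x
    by (rule inj) (use S bounded_clinear_simps[OF A] in simp)
  moreover have "S (?A u) = u" for u
    by (rule inj) (use S in simp)
  ultimately have "z \<notin> spectrum U"
    unfolding spectrum_def bounded_clinear_def using S by blast
  with assms(1) show False
    by contradiction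
qed

lemma unitary_spectrum_unit_circle:
  assumes "z \<in> spectrum U"
  shows "cmod z = 1"
proof (rule ccontr)
  assume "cmod z \<noteq> 1"
  then obtain u where u: "u \<noteq> 0" "norm (U u - z *\<^sub>C u) \<le> \<bar>1 - cmod z\<bar> / 2 * norm u"
    using approximate_eigenvectors_if_spectrum[OF assms, of "\<bar>1 - cmod z\<bar> / 2"] by auto
  have "\<bar>1 - cmod z\<bar> * norm u \<le> norm (U u - z *\<^sub>C u)"
    using norm_triangle_ineq3[of "U u" "z *\<^sub>C u"]
    by (simp add: norm_scaleC abs_mult flip: left_diff_distrib)
      (metis abs_mult abs_norm_cancel left_diff_distrib mult_1)
  also have "\<dots> \<le> (\<bar>1 - cmod z\<bar> * norm u) / 2"
    using u(2) by simp
  finally have "\<bar>1 - cmod z\<bar> * norm u \<le> 0"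
    by linarith
  with u(1) \<open>cmod z \<noteq> 1\<close> show False
    by (simp add: mult_le_0_iff)
qed

end

section \<open>Spectral points close to an approximate eigenvalue\<close>

text \<open>Evaluate the nonnegative form at \<open>x - (1 / M) H x\<close>. In operator terms the
  square of \<open>H\<close> is at most \<open>M H\<close>; so where the form is small, the vector
  \<open>H x\<close> is small too.\<close>

lemma nonneg_form_bound:
  fixes H :: "'a::real_inner \<Rightarrow> 'a"
  assumes "linear H" and sym: "\<And>x y. inner (H x) y = inner x (H y)"
    and nonneg: "\<And>x. 0 \<le> inner (H x) x"
    and M: "M > 0" "\<And>x. norm (H x) \<le> M * norm x"
  shows "(norm (H x))\<^sup>2 \<le> M * inner (H x) x"
proof -
  define t where "t = 1 / M"
  have t: "t > 0" "M * t = 1"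
    using M(1) by (auto simp: t_def)
  have "0 \<le> inner (H (x - t *\<^sub>R H x)) (x - t *\<^sub>R H x)"
    by (rule nonneg)
  also have "\<dots> = inner (H x) x - 2 * t * (norm (H x))\<^sup>2 + t * t * inner (H (H x)) (H x)"
    using assms(1) by (simp add: linear_diff linear_scale inner_diff_left inner_diff_right
        sym[of "H x" x] power2_norm_eq_inner algebra_simps)
  also have "inner (H (H x)) (H x) \<le> M * norm (H x) * norm (H x)"
    using norm_cauchy_schwarz[of "H (H x)" "H x"] mult_right_mono[OF M(2)[of "H x"], of "norm (H x)"]
    by simp
  then have "t * t * inner (H (H x)) (H x) \<le> t * t * (M * norm (H x) * norm (H x))"
    using t by (intro mult_left_mono) auto
  also have "\<dots> = t * (norm (H x))\<^sup>2"
    using t(2) by (simp add: power2_eq_square mult.commute[of t M])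
  finally have "t * (norm (H x))\<^sup>2 \<le> inner (H x) x"
    by linarith
  then show ?thesis
    using M(1) by (simp add: t_def field_simps)
qed

lemma unitary_inv:
  assumes U: "unitary U"
  shows "unitary (inv U)"
proof -
  note s = unitary_simps[OF U]
  have UV: "U (inv U u) = u" for u
    using unitary_surj[OF U] by (simp add: surj_f_inv_f)
  have inj: "inj U"
  proof (rule injI)
    fix u v assume "U u = U v"
    then have "norm (U (u - v)) = 0"
      by (simp add: s)
    then show "u = v"
      using unitary_norm[OF U, of "u - v"] by simp
  qed
  have VU: "inv U (U u) = u" for u
    using inj by (rule inv_f_f)
  have eq: "u = v" if "U u = U v" for u v
    using inj that by (simp add: inj_def)
  have n: "norm (inv U u) = norm u" for u
    using unitary_norm[OF U, of "inv U u"] by (simp add: UV)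
  have c: "inv U (z *\<^sub>C u) = z *\<^sub>C inv U u" for z u
    by (rule eq) (simp add: UV s)
  moreover have "inv U (u + v) = inv U u + inv U v" for u v
    by (rule eq) (simp add: UV s)
  ultimately have "bounded_clinear (inv U)"
    unfolding bounded_clinear_def
    by (auto intro!: bounded_linear_intro[where K = 1] simp: scaleR_scaleC n)
  moreover have "surj (inv U)"
    using VU by (rule surjI)
  ultimately show ?thesis
    using n by (simp add: unitary_def)
qed

text \<open>
  If \<open>\<nu>\<close> is the infimum of \<open>\<parallel>(U - z) x\<parallel>\<close> over unit vectors \<open>x\<close>, then \<open>\<nu>\<^sup>2\<close> is an approximate eigenvalue
  of the symmetric operator \<open>(U - z)\<^sup>* (U - z)\<close>. As \<open>U\<close> is unitary, subtracting \<open>\<nu>\<^sup>2\<close> from that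
  operator gives a quadratic polynomial in \<open>U\<close> (up to a unitary factor), and one of the two roots
  lies in the spectrum, at distance \<open>\<nu>\<close> from \<open>z\<close>. This replaces the functional calculus.
\<close>

lemma unitary_spectrum_near:
  assumes U: "unitary U" and z: "z \<noteq> 0"
    and u: "u \<noteq> 0" "norm (U u - z *\<^sub>C u) \<le> e * norm u"
  shows "\<exists>w\<in>spectrum U. cmod (w - z) \<le> e"
proof -
  note s = unitary_simps[OF U]
  define V where "V = inv U"
  have V: "unitary V"
    unfolding V_def by (rule unitary_inv[OF U])
  note sV = unitary_simps[OF V]
  have UV: "U (V x) = x" for x
    using unitary_surj[OF U] by (simp add: V_def surj_f_inv_f)
  have adj: "inner (V x) y = inner x (U y)" for x y
    using unitary_inner[OF U, of "V x" y] by (simp add: UV)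
  define N where "N = (\<lambda>x. norm (U x - z *\<^sub>C x)) ` {x. norm x = 1}"
  define \<nu> where "\<nu> = Inf N"
  have bdd: "bdd_below N"
    unfolding N_def by (rule bdd_belowI[of _ 0]) auto
  have scale: "norm (U (r *\<^sub>R x) - z *\<^sub>C (r *\<^sub>R x)) = \<bar>r\<bar> * norm (U x - z *\<^sub>C x)" for r x
  proof -
    have "U (r *\<^sub>R x) - z *\<^sub>C (r *\<^sub>R x) = complex_of_real r *\<^sub>C (U x - z *\<^sub>C x)"
      by (simp add: scaleR_scaleC s ell2.scale_right_diff_distrib mult.commute)
    then show ?thesis
      by (simp add: norm_scaleC)
  qed
  have nle: "\<nu> * norm x \<le> norm (U x - z *\<^sub>C x)" for x
  proof (cases "x = 0")
    case False
    have "norm ((1 / norm x) *\<^sub>R x) = 1"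
      using False by simp
    then have "norm (U ((1 / norm x) *\<^sub>R x) - z *\<^sub>C ((1 / norm x) *\<^sub>R x)) \<in> N"
      unfolding N_def by blast
    then have "\<nu> \<le> (1 / norm x) * norm (U x - z *\<^sub>C x)"
      unfolding \<nu>_def scale using cInf_lower[OF _ bdd] by auto
    then show ?thesis
      using False by (simp add: field_simps)
  qed (simp add: s)
  have "\<nu> \<le> e"
  proof -
    have "\<nu> * norm u \<le> e * norm u"
      using nle[of u] u(2) by linarith
    then show ?thesis
      using u(1) by simp
  qed
  have "norm ((1 / norm u) *\<^sub>R u) = 1"
    using u(1) by simp
  then have Nne: "N \<noteq> {}"
    unfolding N_def by blast
  then have "\<nu> \<ge> 0"
    unfolding \<nu>_def by (intro cInf_greatest) (auto simp: N_def)
  have near: "\<exists>x. norm x = 1 \<and> norm (U x - z *\<^sub>C x) < \<nu> + \<eta>" if "\<eta> > 0" for \<eta>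
    using cInf_lessD[OF Nne, of "\<nu> + \<eta>"] that by (auto simp: \<nu>_def N_def)
  \<comment> \<open>As \<open>V\<close> is the adjoint of \<open>U\<close>, the product of
    \<open>U - z\<close> with its adjoint is \<open>1 + (cmod z)\<^sup>2 - cnj z U - z V\<close>.
    Subtracting the square of \<nu> gives \<open>H\<close>, which is nonnegative by the choice of
    \<nu> as an infimum.\<close>
  define c :: real where "c = 1 + (cmod z)\<^sup>2 - \<nu>\<^sup>2"
  define H where "H x = c *\<^sub>R x - cnj z *\<^sub>C U x - z *\<^sub>C V x" for x
  have lin: "linear H"
    by (rule linearI)
       (simp_all add: H_def s sV scaleR_scaleC ell2.scale_right_distrib ell2.scale_right_diff_distrib
          mult.commute)
  have sym: "inner (H x) y = inner x (H y)" for x y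
  proof -
    have "inner (cnj z *\<^sub>C U x) y = inner x (z *\<^sub>C V y)"
    proof -
      have "inner (cnj z *\<^sub>C U x) y = inner (z *\<^sub>C y) (U x)"
        by (subst inner_scaleC_left) (simp add: inner_commute)
      also have "\<dots> = inner x (V (z *\<^sub>C y))"
        by (metis adj inner_commute)
      finally show ?thesis
        by (simp add: sV)
    qed
    moreover have "inner (z *\<^sub>C V x) y = inner x (cnj z *\<^sub>C U y)"
      by (simp add: inner_scaleC_left adj s)
    ultimately show ?thesis
      by (simp add: H_def inner_diff_left inner_diff_right)
  qed
  have form: "inner (H x) x = (norm (U x - z *\<^sub>C x))\<^sup>2 - \<nu>\<^sup>2 * (norm x)\<^sup>2" for x
  proof -
    have 1: "inner (z *\<^sub>C V x) x = inner (U x) (z *\<^sub>C x)"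
    proof -
      have "inner (z *\<^sub>C V x) x = inner x (cnj z *\<^sub>C U x)"
        by (simp add: inner_scaleC_left adj s)
      also have "\<dots> = inner (cnj z *\<^sub>C U x) x"
        by (rule inner_commute)
      finally show ?thesis
        by (subst (asm) (2) inner_scaleC_left) simp
    qed
    have 2: "inner (cnj z *\<^sub>C U x) x = inner (U x) (z *\<^sub>C x)"
      by (simp add: inner_scaleC_left)
    have "(norm (U x - z *\<^sub>C x))\<^sup>2 =
        (norm x)\<^sup>2 - 2 * inner (U x) (z *\<^sub>C x) + (cmod z)\<^sup>2 * (norm x)\<^sup>2"
    proof -
      have "(norm (a - b))\<^sup>2 = (norm a)\<^sup>2 - 2 * inner a b + (norm b)\<^sup>2" for a b :: "'a ell2"
        by (simp add: power2_norm_eq_inner inner_diff_left inner_diff_right inner_commute)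
      then show ?thesis
        by (simp add: unitary_norm[OF U] norm_scaleC power_mult_distrib)
    qed
    then show ?thesis
      unfolding H_def inner_diff_left 1 2
      by (simp add: c_def power2_norm_eq_inner algebra_simps)
  qed
  have pos: "0 \<le> inner (H x) x" for x
  proof -
    have "(\<nu> * norm x)\<^sup>2 \<le> (norm (U x - z *\<^sub>C x))\<^sup>2"
      using nle[of x] \<open>\<nu> \<ge> 0\<close> by (intro power_mono) auto
    then show ?thesis
      unfolding form by (simp add: power_mult_distrib)
  qed
  define M where "M = \<bar>c\<bar> + 2 * cmod z"
  have M: "M > 0"
    using z by (simp add: M_def add_nonneg_pos)
  have bd: "norm (H x) \<le> M * norm x" for x
  proof -
    have "norm (H x) \<le> norm (c *\<^sub>R x) + norm (cnj z *\<^sub>C U x) + norm (z *\<^sub>C V x)"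
      unfolding H_def by (meson add_right_mono norm_triangle_ineq4 order_trans)
    then show ?thesis
      by (simp add: norm_scaleC unitary_norm[OF U] unitary_norm[OF V] M_def algebra_simps)
  qed
  \<comment> \<open>Multiplying \<open>H\<close> by \<open>U\<close> removes \<open>V\<close> and
    leaves minus the polynomial \<open>cnj z X\<^sup>2 - c X + z\<close> in \<open>U\<close>. Its
    roots are \<open>l1\<close> and \<open>l2\<close>; the division by \<open>cnj z\<close> is where
    \<open>z \<noteq> 0\<close> enters.\<close>
  define p where "p = complex_of_real c / cnj z / 2"
  define d where "d = csqrt (p\<^sup>2 - z / cnj z)"
  define l1 l2 where "l1 = p + d" and "l2 = p - d"
  have sm: "cnj z * (l1 + l2) = complex_of_real c"
    using z by (simp add: l1_def l2_def p_def)
  have "l1 * l2 = p\<^sup>2 - d\<^sup>2"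
    by (simp add: l1_def l2_def power2_eq_square algebra_simps)
  then have pr: "cnj z * (l1 * l2) = z"
    using z by (simp add: d_def)
  have fac: "norm (H x) = cmod z * norm (U (U x - l2 *\<^sub>C x) - l1 *\<^sub>C (U x - l2 *\<^sub>C x))" for x
  proof -
    have "U (H x) = - (cnj z *\<^sub>C (U (U x - l2 *\<^sub>C x) - l1 *\<^sub>C (U x - l2 *\<^sub>C x)))"
    proof (rule ell2_eqI)
      fix i
      let ?a = "ell2_coord (U (U x)) i" and ?b = "ell2_coord (U x) i" and ?c = "ell2_coord x i"
      have "ell2_coord (U (H x)) i = complex_of_real c * ?b - cnj z * ?a - z * ?c"
        by (simp add: H_def s UV scaleR_scaleC)
      also have "\<dots> = cnj z * (l1 + l2) * ?b - cnj z * ?a - cnj z * (l1 * l2) * ?c"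
        by (simp add: sm pr)
      also have "\<dots> = ell2_coord (- (cnj z *\<^sub>C (U (U x - l2 *\<^sub>C x) - l1 *\<^sub>C (U x - l2 *\<^sub>C x)))) i"
        by (simp add: s algebra_simps)
      finally show "ell2_coord (U (H x)) i = \<dots>" .
    qed
    then have "norm (U (H x)) = cmod z * norm (U (U x - l2 *\<^sub>C x) - l1 *\<^sub>C (U x - l2 *\<^sub>C x))"
      by (simp add: norm_scaleC)
    then show ?thesis
      by (simp add: unitary_norm[OF U])
  qed
  have "l1 \<in> spectrum U \<or> l2 \<in> spectrum U"
  proof (rule ccontr)
    have below: "\<exists>\<delta>>0. \<forall>x. \<delta> * norm x \<le> norm (U x - l *\<^sub>C x)" if "l \<notin> spectrum U" for l
      using spectrum_if_approximate_eigenvectors[of U l] that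
      by (metis linorder_le_cases norm_zero mult_zero_right norm_ge_zero)
    assume "\<not> ?thesis"
    then obtain d1 d2 where d: "d1 > 0" "\<And>x. d1 * norm x \<le> norm (U x - l1 *\<^sub>C x)"
      "d2 > 0" "\<And>x. d2 * norm x \<le> norm (U x - l2 *\<^sub>C x)"
      using below by meson
    define \<kappa> where "\<kappa> = cmod z * (d1 * d2)"
    have \<kappa>: "\<kappa> > 0"
      using z d by (simp add: \<kappa>_def)
    have low: "\<kappa> * norm x \<le> norm (H x)" for x
    proof -
      have "d1 * (d2 * norm x) \<le> d1 * norm (U x - l2 *\<^sub>C x)"
        using d by simp
      also have "\<dots> \<le> norm (U (U x - l2 *\<^sub>C x) - l1 *\<^sub>C (U x - l2 *\<^sub>C x))"
        by (rule d)
      finally show ?thesis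
        unfolding fac \<kappa>_def by (simp add: mult.assoc mult_left_mono)
    qed
    \<comment> \<open>Chosen so that a unit vector within \<eta> of the infimum has
      \<open>M * inner (H x) x\<close> at most half the square of \<kappa>, against the lower bound
      by the full square. The cap at 1 replaces \<open>2 * \<nu> + \<eta>\<close> by
      \<open>2 * \<nu> + 1\<close>.\<close>
    define \<eta> where "\<eta> = min 1 (\<kappa>\<^sup>2 / (2 * M * (2 * \<nu> + 1)))"
    have \<eta>: "\<eta> > 0" "\<eta> \<le> 1"
      using \<kappa> M \<open>\<nu> \<ge> 0\<close> by (auto simp: \<eta>_def)
    have \<eta>3: "\<eta> \<le> \<kappa>\<^sup>2 / (2 * M * (2 * \<nu> + 1))"
      by (simp add: \<eta>_def)
    have \<eta>2: "M * (\<eta> * (2 * \<nu> + 1)) \<le> \<kappa>\<^sup>2 / 2"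
    proof -
      have "2 * M * (2 * \<nu> + 1) > 0"
        using M \<open>\<nu> \<ge> 0\<close> by simp
      with \<eta>3 have "\<eta> * (2 * M * (2 * \<nu> + 1)) \<le> \<kappa>\<^sup>2"
        by (simp only: pos_le_divide_eq)
      then show ?thesis
        by (simp add: algebra_simps)
    qed
    obtain x where x: "norm x = 1" "norm (U x - z *\<^sub>C x) < \<nu> + \<eta>"
      using near[OF \<eta>(1)] by blast
    have "\<kappa>\<^sup>2 \<le> (norm (H x))\<^sup>2"
      using low[of x] x(1) \<kappa> by (intro power_mono) auto
    also have "\<dots> \<le> M * inner (H x) x"
      by (rule nonneg_form_bound[OF lin sym pos M bd])
    also have "\<dots> \<le> M * (\<eta> * (2 * \<nu> + 1))"
    proof (rule mult_left_mono)
      have "(norm (U x - z *\<^sub>C x))\<^sup>2 \<le> (\<nu> + \<eta>)\<^sup>2"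
        using x(2) by (intro power_mono) auto
      then have "inner (H x) x \<le> \<eta> * (2 * \<nu> + \<eta>)"
        unfolding form x(1) by (simp add: power2_eq_square algebra_simps)
      also have "\<dots> \<le> \<eta> * (2 * \<nu> + 1)"
        using \<eta> by (intro mult_left_mono) auto
      finally show "inner (H x) x \<le> \<eta> * (2 * \<nu> + 1)" .
    qed (use M in auto)
    also note \<eta>2
    finally show False
      using \<kappa> by simp
  qed
  then obtain l where l: "l \<in> spectrum U" "l = l1 \<or> l = l2"
    by blast
  have "l * l - (l1 + l2) * l + l1 * l2 = 0"
    using l(2) by (auto simp: algebra_simps)
  then have "cnj z * (l * l - (l1 + l2) * l + l1 * l2) = 0"
    by simp
  then have q: "cnj z * l * l - complex_of_real c * l + z = 0"
    using sm pr by (simp add: right_diff_distrib distrib_left flip: mult.assoc)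
  have l1': "cmod l = 1"
    using unitary_spectrum_unit_circle[OF U l(1)] .
  then have ll: "l * cnj l = 1"
    by (simp add: complex_norm_square[symmetric])
  \<comment> \<open>On the unit circle \<open>cnj l\<close> is the inverse of \<open>l\<close>.
    Dividing the quadratic equation by \<open>l\<close> makes it the real condition
    \<open>2 * Re (l * cnj z) = c\<close>, which says that \<open>l\<close> has distance \<nu> from
    \<open>z\<close>.\<close>
  have "cnj l * (cnj z * l * l - complex_of_real c * l + z) = 0"
    using q by simp
  then have "cnj z * l * (l * cnj l) - complex_of_real c * (l * cnj l) + z * cnj l = 0"
    by (simp add: algebra_simps)
  then have "cnj z * l + z * cnj l = complex_of_real c"
    unfolding ll by (simp add: algebra_simps)
  then have "Re (cnj z * l + z * cnj l) = c"
    by simp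
  then have re: "2 * Re (l * cnj z) = c"
    by simp
  have "(cmod (l - z))\<^sup>2 = (cmod l)\<^sup>2 + (cmod z)\<^sup>2 - 2 * Re (l * cnj z)"
    unfolding cmod_power2 by (simp add: power2_eq_square algebra_simps)
  then have "(cmod (l - z))\<^sup>2 = \<nu>\<^sup>2"
    unfolding re l1' by (simp add: c_def)
  then have "cmod (l - z) = \<nu>"
    using \<open>\<nu> \<ge> 0\<close> by (simp add: power2_eq_iff_nonneg)
  with l(1) \<open>\<nu> \<le> e\<close> show ?thesis
    by blast
qed


section \<open>Fredholm shifts of unitary operators\<close>

text \<open>Linear algebra by elimination, without bases: two combinations with disjoint index sets
  lie in the span of \<open>V\<close> and \<open>b\<close>, and eliminating \<open>b\<close> brings
  one into \<open>V\<close>. The lower bound \<open>N\<close> on the indices is there to make the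
  two index sets disjoint in the induction.\<close>

lemma (in vector_space) finite_codim_combination:
  assumes "finite B" "subspace V" "span (V \<union> B) = UNIV"
  shows "\<exists>I a. finite I \<and> (\<forall>i\<in>I. N \<le> i) \<and> (\<exists>i\<in>I. a i \<noteq> 0) \<and> (\<Sum>i\<in>I. scale (a i) (f (i::nat))) \<in> V"
  using assms
proof (induction B arbitrary: V N)
  case empty
  then have "V = UNIV"
    using span_eq_iff[of V] by auto
  then show ?case
    by (intro exI[of _ "{N}"] exI[of _ "\<lambda>_. 1"]) auto
next
  case (insert b B)
  let ?V = "span (insert b V)"
  have sp: "span (?V \<union> B) = UNIV"
  proof -
    have "V \<union> insert b B \<subseteq> ?V \<union> B"
      using span_superset[of "insert b V"] by blast
    from span_mono[OF this] show ?thesis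
      using insert.prems(2) by blast
  qed
  obtain I1 a1 where 1: "finite I1" "\<forall>i\<in>I1. N \<le> i" "\<exists>i\<in>I1. a1 i \<noteq> 0"
      "(\<Sum>i\<in>I1. scale (a1 i) (f i)) \<in> ?V"
    using insert.IH[OF _ sp, of N] by auto
  obtain I2 a2 where 2: "finite I2" "\<forall>i\<in>I2. max N (Suc (Max I1)) \<le> i" "\<exists>i\<in>I2. a2 i \<noteq> 0"
      "(\<Sum>i\<in>I2. scale (a2 i) (f i)) \<in> ?V"
    using insert.IH[OF _ sp, of "max N (Suc (Max I1))"] by auto
  have disj: "I1 \<inter> I2 = {}"
    using 1(1) 2(2) Max_ge by fastforce
  have spV: "span V = V"
    using insert.prems(1) by (simp add: span_eq_iff)
  obtain k1 where k1: "(\<Sum>i\<in>I1. scale (a1 i) (f i)) - scale k1 b \<in> V"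
    using 1(4) by (auto simp: span_breakdown_eq spV)
  obtain k2 where k2: "(\<Sum>i\<in>I2. scale (a2 i) (f i)) - scale k2 b \<in> V"
    using 2(4) by (auto simp: span_breakdown_eq spV)
  show ?case
  proof (cases "k1 = 0")
    case True
    then show ?thesis
      using 1 k1 by auto
  next
    case False
    \<comment> \<open>These factors cancel the multiples \<open>k1\<close> and \<open>k2\<close> of
      \<open>b\<close>. Since \<open>k1\<close> is nonzero, the second combination keeps a nonzero
      coefficient.\<close>
    define a where "a i = (if i \<in> I1 then - k2 * a1 i else k1 * a2 i)" for i
    have "(\<Sum>i\<in>I1 \<union> I2. scale (a i) (f i)) = (\<Sum>i\<in>I1. scale (a i) (f i)) + (\<Sum>i\<in>I2. scale (a i) (f i))"
      using 1 2 disj by (intro sum.union_disjoint)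
    also have "(\<Sum>i\<in>I1. scale (a i) (f i)) = scale (- k2) (\<Sum>i\<in>I1. scale (a1 i) (f i))"
      unfolding scale_sum_right by (intro sum.cong) (auto simp: a_def)
    also have "(\<Sum>i\<in>I2. scale (a i) (f i)) = scale k1 (\<Sum>i\<in>I2. scale (a2 i) (f i))"
      unfolding scale_sum_right using disj by (intro sum.cong) (auto simp: a_def)
    also have "scale (- k2) (\<Sum>i\<in>I1. scale (a1 i) (f i)) + scale k1 (\<Sum>i\<in>I2. scale (a2 i) (f i)) =
        scale (- k2) ((\<Sum>i\<in>I1. scale (a1 i) (f i)) - scale k1 b) + scale k1 ((\<Sum>i\<in>I2. scale (a2 i) (f i)) - scale k2 b)"
      by (simp add: scale_right_diff_distrib mult.commute)
    also have "\<dots> \<in> V"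
      using insert.prems(1) k1 k2 by (intro subspace_add subspace_scale)
    finally have "(\<Sum>i\<in>I1 \<union> I2. scale (a i) (f i)) \<in> V" .
    moreover obtain i where "i \<in> I2" "a2 i \<noteq> 0"
      using 2 by blast
    then have "i \<in> I1 \<union> I2" "a i \<noteq> 0"
      using disj False by (auto simp: a_def)
    ultimately show ?thesis
      using 1 2 by (intro exI[of _ "I1 \<union> I2"] exI[of _ a]) auto
  qed
qed

text \<open>The first \<open>N\<close> coordinates embed \<open>V\<close> in a space of dimension
  \<open>N\<close>. In the induction, the kernel of one coordinate functional has codimension at
  most one in \<open>V\<close>.\<close>

lemma finite_dim_if_determined_by_initial_coords:
  assumes "ell2.subspace V"
    and "\<And>u :: nat ell2. u \<in> V \<Longrightarrow> (\<And>i. i < N \<Longrightarrow> ell2_coord u i = 0) \<Longrightarrow> u = 0"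
  shows "\<exists>B. finite B \<and> V \<subseteq> ell2.span B"
  using assms
proof (induction N arbitrary: V)
  case 0
  then show ?case
    by (intro exI[of _ "{}"]) auto
next
  case (Suc N)
  define W where "W = {u \<in> V. ell2_coord u N = 0}"
  have "ell2.subspace W"
    using Suc.prems(1) unfolding ell2.subspace_def W_def by auto
  then obtain B where B: "finite B" "W \<subseteq> ell2.span B"
    using Suc.IH[of W] Suc.prems(2) by (auto simp: W_def less_Suc_eq)
  show ?case
  proof (cases "W = V")
    case False
    then obtain e where e: "e \<in> V" "ell2_coord e N \<noteq> 0"
      by (auto simp: W_def)
    have "u \<in> ell2.span (insert e B)" if "u \<in> V" for u
    proof -
      let ?k = "ell2_coord u N / ell2_coord e N"
      have "u - ?k *\<^sub>C e \<in> W"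
        using that e Suc.prems(1) by (auto simp: W_def ell2.subspace_diff ell2.subspace_scale)
      then show ?thesis
        unfolding ell2.span_breakdown_eq using B(2) by blast
    qed
    then show ?thesis
      using B(1) by (intro exI[of _ "insert e B"]) auto
  qed (use B in blast)
qed

text \<open>The positive distance \<open>d\<close> from \<open>b\<close> to \<open>Y\<close>
  controls the coefficient of \<open>b\<close>:
  \<open>cmod c * d \<le> norm (y + c *\<^sub>C b)\<close>. In a convergent sequence the
  coefficients are therefore Cauchy, and the components in \<open>Y\<close> converge as
  well.\<close>

lemma closed_csubspace_plus_line:
  fixes Y :: "'i ell2 set"
  assumes Y: "closed Y" "ell2.subspace Y"
  shows "closed (ell2.span (insert b Y))"
proof (cases "b \<in> Y")
  case True
  then have "ell2.span (insert b Y) = Y"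
    using Y(2) by (simp add: insert_absorb)
  with Y(1) show ?thesis
    by simp
next
  case False
  define d where "d = infdist b Y"
  have d: "d > 0"
    using infdist_pos_not_in_closed[OF Y(1) _ False] ell2.subspace_0[OF Y(2)] by (auto simp: d_def)
  have spY: "ell2.span Y = Y"
    using Y(2) by simp
  have low: "cmod c * d \<le> norm (y + c *\<^sub>C b)" if "y \<in> Y" for c y
  proof (cases "c = 0")
    case False
    have "(- 1 / c) *\<^sub>C y \<in> Y"
      using that Y(2) by (intro ell2.subspace_scale)
    then have "d \<le> norm (b - (- 1 / c) *\<^sub>C y)"
      unfolding d_def dist_norm[symmetric] by (rule infdist_le)
    then have "cmod c * d \<le> norm (c *\<^sub>C (b - (- 1 / c) *\<^sub>C y))"
      by (simp add: norm_scaleC mult_left_mono)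
    also have "c *\<^sub>C (b - (- 1 / c) *\<^sub>C y) = y + c *\<^sub>C b"
      using False by (intro ell2_eqI) (simp add: algebra_simps)
    finally show ?thesis .
  qed simp
  show ?thesis
    unfolding closed_sequential_limits
  proof (intro allI impI)
    fix g l assume "(\<forall>n. g n \<in> ell2.span (insert b Y)) \<and> g \<longlonglongrightarrow> l"
    then have g: "\<And>n. \<exists>c. g n - c *\<^sub>C b \<in> Y" and gl: "g \<longlonglongrightarrow> l"
      by (auto simp: ell2.span_breakdown_eq spY)
    from g obtain c where c: "\<And>n. g n - c n *\<^sub>C b \<in> Y"
      by metis
    have cd: "cmod (c m - c n) * d \<le> norm (g m - g n)" for m n
    proof -
      have "(g m - c m *\<^sub>C b) - (g n - c n *\<^sub>C b) \<in> Y"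
        by (rule ell2.subspace_diff[OF Y(2) c c])
      from low[OF this, of "c m - c n"] show ?thesis
        by (simp add: ell2.scale_left_diff_distrib)
    qed
    have "Cauchy c"
    proof (rule metric_CauchyI)
      fix e :: real assume "e > 0"
      then obtain M where M: "\<And>m n. m \<ge> M \<Longrightarrow> n \<ge> M \<Longrightarrow> dist (g m) (g n) < e * d"
        using metric_CauchyD[OF LIMSEQ_imp_Cauchy[OF gl], of "e * d"] d by auto
      have "dist (c m) (c n) < e" if "m \<ge> M" "n \<ge> M" for m n
      proof -
        have "cmod (c m - c n) * d < e * d"
          using cd[of m n] M[OF that] by (simp add: dist_norm)
        then show ?thesis
          using d by (simp add: dist_norm)
      qed
      then show "\<exists>M. \<forall>m\<ge>M. \<forall>n\<ge>M. dist (c m) (c n) < e"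
        by blast
    qed
    then obtain k where k: "c \<longlonglongrightarrow> k"
      using Cauchy_convergent convergent_def by blast
    have "(\<lambda>n. g n - c n *\<^sub>C b) \<longlonglongrightarrow> l - k *\<^sub>C b"
      by (intro tendsto_diff gl bounded_linear.tendsto[OF bounded_linear_scaleC_left k])
    then have "l - k *\<^sub>C b \<in> Y"
      by (rule closed_sequentially[OF Y(1) c])
    then show "l \<in> ell2.span (insert b Y)"
      by (auto simp: ell2.span_breakdown_eq spY)
  qed
qed

section \<open>Fredholm property and vectors supported far out\<close>

text \<open>A kernel vector is determined by its first \<open>N\<close> coordinates, so the kernel
  is finite-dimensional. The image of the tail space is complete, and readmitting the remaining
  coordinates one by one keeps the image closed.\<close>

lemma fredholm_if_bounded_below_on_tail:
  fixes C :: "nat ell2 \<Rightarrow> nat ell2"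
  assumes C: "unitary C" and \<delta>: "\<delta> > 0"
    and below: "\<And>u. (\<And>i. i < N \<Longrightarrow> ell2_coord u i = 0) \<Longrightarrow> \<delta> * norm u \<le> norm (C u - z *\<^sub>C u)"
  shows "fredholm (\<lambda>u. C u - z *\<^sub>C u)"
proof -
  let ?A = "\<lambda>u. C u - z *\<^sub>C u"
  have A: "bounded_clinear ?A"
    by (intro bounded_clinear_shift unitary_clinear C)
  define X where "X n = {u :: nat ell2. \<forall>i<n. ell2_coord u i = 0}" for n
  have X: "ell2.subspace (X n)" for n
    unfolding ell2.subspace_def X_def by auto
  have Xcl: "closed (X n)" for n
  proof -
    have "X n = (\<Inter>i\<in>{..<n}. (\<lambda>u. ell2_coord u i) -` {0})"
      by (auto simp: X_def)
    then show ?thesis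
      by (auto intro!: closed_INT continuous_closed_vimage linear_continuous_at bounded_linear_ell2_coord)
  qed
  have "ell2.subspace {u. ?A u = 0}"
    unfolding ell2.subspace_def
    by (auto simp: bounded_clinear_simps[OF unitary_clinear[OF C]] ell2.scale_right_distrib mult.commute)
  moreover have "u = 0" if "?A u = 0" "\<And>i. i < N \<Longrightarrow> ell2_coord u i = 0" for u
    using below[of u] that \<delta> by (simp add: mult_le_0_iff)
  ultimately obtain B where B: "finite B" "{u. ?A u = 0} \<subseteq> ell2.span B"
    using finite_dim_if_determined_by_initial_coords[of "{u. ?A u = 0}" N] by auto
  have "complete (?A ` X N)"
    by (rule complete_isometric_image[OF \<delta> csubspace_imp_subspace[OF X]])
       (use A below Xcl in \<open>auto simp: bounded_clinear_def X_def complete_eq_closed\<close>)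
  then have base: "closed (?A ` X N)"
    by (rule complete_imp_closed)
  \<comment> \<open>Freeing coordinate \<open>n\<close> adds at most one direction to the tail
    space, hence at most one line to the image.\<close>
  have step: "closed (?A ` X n)" if cl: "closed (?A ` X (Suc n))" for n
  proof (cases "X n = X (Suc n)")
    case False
    then obtain e where e: "e \<in> X n" "ell2_coord e n \<noteq> 0"
      by (auto simp: X_def less_Suc_eq)
    have sub: "ell2.subspace (?A ` X (Suc n))" for n
      by (rule clinear_subspace_image[OF A X])
    have "?A ` X n = ell2.span (insert (?A e) (?A ` X (Suc n)))"
    proof (intro equalityI subsetI)
      fix x assume "x \<in> ?A ` X n"
      then obtain u where u: "x = ?A u" "u \<in> X n"
        by blast
      let ?k = "ell2_coord u n / ell2_coord e n"
      have "u - ?k *\<^sub>C e \<in> X (Suc n)"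
        using u e by (auto simp: X_def less_Suc_eq)
      then have "?A (u - ?k *\<^sub>C e) \<in> ell2.span (?A ` X (Suc n))"
        by (intro ell2.span_base imageI)
      moreover have "?A (u - ?k *\<^sub>C e) = x - ?k *\<^sub>C ?A e"
        unfolding u(1) using bounded_clinear_simps(2,4)[OF A] by metis
      ultimately show "x \<in> ell2.span (insert (?A e) (?A ` X (Suc n)))"
        by (auto simp: ell2.span_breakdown_eq)
    next
      fix x assume "x \<in> ell2.span (insert (?A e) (?A ` X (Suc n)))"
      moreover have "insert (?A e) (?A ` X (Suc n)) \<subseteq> ?A ` X n"
        using e by (auto simp: X_def)
      ultimately show "x \<in> ?A ` X n"
        using ell2.span_minimal[OF _ clinear_subspace_image[OF A X]] by blast
    qed
    then show ?thesis
      using closed_csubspace_plus_line[OF cl sub] by simp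
  qed (use that in simp)
  have "closed (?A ` X (N - k))" for k
  proof (induction k)
    case (Suc k)
    show ?case
    proof (cases "k < N")
      case True
      then have "N - k = Suc (N - Suc k)"
        by simp
      with Suc step[of "N - Suc k"] show ?thesis
        by simp
    qed (use Suc in simp)
  qed (use base in simp)
  from this[of N] have cl: "closed (range ?A)"
    by (simp add: X_def)
  \<comment> \<open>The complement of the closed range is the kernel, so the set \<open>B\<close>
    that spans the kernel also bounds the codimension.\<close>
  have "f \<in> ell2.span (range ?A \<union> B)" for f
  proof -
    obtain u w where "f = ?A u + w" "?A w = 0"
      using unitary_range_complement[OF C cl] .
    moreover have "?A u \<in> ell2.span (range ?A \<union> B)"
      by (intro ell2.span_base) blast
    moreover have "w \<in> ell2.span (range ?A \<union> B)"
      using B(2) \<open>?A w = 0\<close> ell2.span_mono[of B "range ?A \<union> B"] by blast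
    ultimately show ?thesis
      by (simp add: ell2.span_add)
  qed
  then show ?thesis
    unfolding fredholm_def using B cl by blast
qed

lemma inner_disjoint_support:
  assumes "\<And>i. ell2_coord u i = 0 \<or> ell2_coord v i = 0"
  shows "inner u v = 0"
proof -
  have "ell2_coord u i \<bullet> ell2_coord v i = 0" for i
    using assms[of i] by auto
  then show ?thesis
    by (simp add: inner_ell2_def)
qed

text \<open>What fails is finite codimension. The vectors \<open>f i\<close> carry weights
  \<open>(1 / 2) ^ k\<close> along disjointly supported unit vectors \<open>y k\<close>, whereas an
  element \<open>?A g\<close> of the range pairs with \<open>y k\<close> to at most
  \<open>norm g * (1 / 4) ^ k\<close>. A nontrivial combination of the \<open>f i\<close> decays too
  slowly to lie in the range.\<close>

lemma not_fredholm_if_escaping: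
  fixes C :: "nat ell2 \<Rightarrow> nat ell2"
  assumes C: "unitary C"
    and esc: "\<And>e N. e > 0 \<Longrightarrow> \<exists>u M. u \<noteq> 0 \<and> (\<forall>i. ell2_coord u i \<noteq> 0 \<longrightarrow> N \<le> i \<and> i < M) \<and>
      norm (C u - z *\<^sub>C u) \<le> e * norm u"
  shows "\<not> fredholm (\<lambda>u. C u - z *\<^sub>C u)"
proof
  let ?A = "\<lambda>u. C u - z *\<^sub>C u"
  have A: "bounded_clinear ?A"
    by (intro bounded_clinear_shift unitary_clinear C)
  note As = bounded_clinear_simps[OF A]
  have Ascale: "norm (?A (c *\<^sub>C u)) = cmod c * norm (?A u)" for c u
    unfolding As(4) norm_scaleC ..
  define Q where "Q k N M u \<longleftrightarrow> norm u = 1 \<and> (\<forall>i. ell2_coord u i \<noteq> 0 \<longrightarrow> N \<le> i \<and> i < M) \<and>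
      norm (?A u) \<le> (1 / 4) ^ k" for k N M u
  have "\<exists>M u. Q k N M u" for k N
  proof -
    obtain u M where u: "u \<noteq> 0" "\<And>i. ell2_coord u i \<noteq> 0 \<Longrightarrow> N \<le> i \<and> i < M"
        "norm (?A u) \<le> (1 / 4) ^ k * norm u"
      using esc[of "(1 / 4) ^ k" N] by auto
    define c where "c = complex_of_real (1 / norm u)"
    have c: "cmod c = 1 / norm u"
      by (simp add: c_def norm_divide)
    have "norm (?A (c *\<^sub>C u)) \<le> (1 / 4) ^ k"
      unfolding Ascale c using u(1,3) by (simp add: field_simps)
    moreover have "norm (c *\<^sub>C u) = 1"
      using u(1) by (simp add: norm_scaleC c)
    moreover have "\<forall>i. ell2_coord (c *\<^sub>C u) i \<noteq> 0 \<longrightarrow> N \<le> i \<and> i < M"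
      using u(2) by simp
    ultimately show ?thesis
      unfolding Q_def by blast
  qed
  then obtain m x where "\<And>k N. Q k N (m k N) (x k N)"
    by metis
  then have mx: "norm (x k N) = 1"
      "ell2_coord (x k N) i \<noteq> 0 \<Longrightarrow> N \<le> i \<and> i < m k N"
      "norm (?A (x k N)) \<le> (1 / 4) ^ k" for k N i
    unfolding Q_def by auto
  \<comment> \<open>Each support ends before the bound that is handed to the next choice, so
    \<open>y k\<close> lives on the indices from \<open>b k\<close> up to, but excluding,
    \<open>b (Suc k)\<close>.\<close>
  define b where "b = rec_nat (0::nat) m"
  define y where "y k = x k (b k)" for k
  have bS: "b (Suc k) = m k (b k)" for k
    by (simp add: b_def)
  have y1: "norm (y k) = 1" and yA: "norm (?A (y k)) \<le> (1 / 4) ^ k" for k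
    by (auto simp: y_def mx)
  have ys: "b k \<le> i \<and> i < b (Suc k)" if "ell2_coord (y k) i \<noteq> 0" for k i
    using mx(2) that unfolding y_def bS by blast
  have "b k \<le> b (Suc k)" for k
  proof -
    have "y k \<noteq> 0"
      using y1[of k] by auto
    then obtain i where "ell2_coord (y k) i \<noteq> 0"
      using ell2_eqI[of "y k" 0] by auto
    then show ?thesis
      using ys by fastforce
  qed
  then have bmono: "b j \<le> b k" if "j \<le> k" for j k
    using lift_Suc_mono_le that by blast
  have disj: "ell2_coord (y j) i = 0 \<or> ell2_coord (y k) i = 0" if "j < k" for i j k
    using ys[of j i] ys[of k i] bmono[of "Suc j" k] that by fastforce
  have orth: "inner (c *\<^sub>C y j) (d *\<^sub>C y k) = 0" if "j \<noteq> k" for c d j k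
    by (rule inner_disjoint_support) (use disj[of j k] disj[of k j] that in \<open>fastforce simp: neq_iff\<close>)
  \<comment> \<open>The pairing function splits the natural numbers into infinitely many infinite
    classes, one for each \<open>f i\<close>; \<open>n \<le> e i n\<close> lets bounds in
    \<open>e i n\<close> pass to bounds in \<open>n\<close>.\<close>
  define e where "e i n = prod_encode (i, n)" for i n :: nat
  have e_ge: "n \<le> e i n" for i n
    by (simp add: e_def le_prod_encode_2)
  have e_inj: "e i n = e i' n' \<longleftrightarrow> i = i' \<and> n = n'" for i n i' n'
    by (simp add: e_def)
  \<comment> \<open>The ratio 1/2 is summable, yet larger than the accuracy ratio 1/4 of the
    \<open>y k\<close>.\<close>
  define t where "t i n = (1 / 2) ^ e i n *\<^sub>R y (e i n)" for i n
  define f where "f i = (\<Sum>n. t i n)" for i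
  have "summable (\<lambda>n. norm (t i n))" for i
  proof (rule summable_comparison_test)
    show "\<exists>N. \<forall>n\<ge>N. norm (norm (t i n)) \<le> (1 / 2) ^ n"
      using power_decreasing[OF e_ge, of "1/2 :: real"] by (auto simp: t_def y1)
    show "summable (\<lambda>n. (1 / 2 :: real) ^ n)"
      by (rule summable_geometric) simp
  qed
  then have fs: "t i sums f i" for i
    unfolding f_def by (rule summable_sums[OF summable_norm_cancel])
  have ip: "inner (c *\<^sub>C f i) (d *\<^sub>C y (e j n)) =
      (if i = j then (1 / 2) ^ e j n * inner (c *\<^sub>C y (e j n)) (d *\<^sub>C y (e j n)) else 0)" for c d i j n
  proof -
    have "bounded_linear (\<lambda>x. inner (c *\<^sub>C x) (d *\<^sub>C y (e j n)))"
      by (rule bounded_linear_compose[OF bounded_linear_inner_left bounded_linear_scaleC_right])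
    from bounded_linear.sums[OF this fs[of i]]
    have "(\<lambda>r. inner (c *\<^sub>C t i r) (d *\<^sub>C y (e j n))) sums inner (c *\<^sub>C f i) (d *\<^sub>C y (e j n))" .
    moreover have "inner (c *\<^sub>C t i r) (d *\<^sub>C y (e j n)) =
        (1 / 2) ^ e i r * inner (c *\<^sub>C y (e i r)) (d *\<^sub>C y (e j n))" for r
    proof -
      have "c *\<^sub>C t i r = (1 / 2) ^ e i r *\<^sub>R (c *\<^sub>C y (e i r))"
        by (simp add: t_def scaleR_scaleC mult.commute)
      then show ?thesis
        by simp
    qed
    moreover have "\<dots> r = (if r = n then (if i = j then (1 / 2) ^ e j n *
        inner (c *\<^sub>C y (e j n)) (d *\<^sub>C y (e j n)) else 0) else 0)" for r
      using orth[of "e i r" "e j n" c d] by (auto simp: e_inj)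
    ultimately have "(\<lambda>r. if r = n then (if i = j then (1 / 2) ^ e j n *
        inner (c *\<^sub>C y (e j n)) (d *\<^sub>C y (e j n)) else 0) else 0) sums
        inner (c *\<^sub>C f i) (d *\<^sub>C y (e j n))"
      by simp
    from sums_unique2[OF this sums_single[of n]] show ?thesis
      by simp
  qed
  assume "fredholm ?A"
  then obtain B where B: "finite B" "ell2.span (range ?A \<union> B) = UNIV"
    unfolding fredholm_def by blast
  have "ell2.subspace (range ?A)"
    by (intro clinear_subspace_image A) simp
  from ell2.finite_codim_combination[OF B(1) this B(2), of 0 f]
  obtain I a i0 where I: "finite I" "i0 \<in> I" "a i0 \<noteq> 0" "(\<Sum>i\<in>I. a i *\<^sub>C f i) \<in> range ?A"
    by blast
  then obtain g where g: "(\<Sum>i\<in>I. a i *\<^sub>C f i) = ?A g"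
    by blast
  have bound: "cmod (a i0) \<le> norm g * (1 / 2) ^ n" for n
  proof -
    \<comment> \<open>Including the scalar \<open>a i0\<close> makes the real pairing equal to a
      positive multiple of \<open>(cmod (a i0))\<^sup>2\<close>, so no phase can hide the
      coefficient.\<close>
    let ?w = "a i0 *\<^sub>C y (e i0 n)"
    have "inner (?A g) ?w = (\<Sum>i\<in>I. inner (a i *\<^sub>C f i) ?w)"
      by (simp flip: g add: inner_sum_left)
    also have "\<dots> = (1 / 2) ^ e i0 n * inner ?w ?w"
      unfolding ip using I by simp
    also have "inner ?w ?w = (cmod (a i0))\<^sup>2"
      by (simp add: norm_scaleC y1 flip: power2_norm_eq_inner)
    finally have "(1 / 2) ^ e i0 n * (cmod (a i0))\<^sup>2 \<le> norm g * norm (?A ?w)"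
      using unitary_inner_shift_le[OF C, of g z ?w] by simp
    also have "\<dots> \<le> norm g * (cmod (a i0) * (1 / 4) ^ e i0 n)"
      unfolding Ascale by (intro mult_left_mono yA) auto
    also have "(1 / 4 :: real) ^ e i0 n = (1 / 2) ^ e i0 n * (1 / 2) ^ e i0 n"
      by (simp flip: power_mult_distrib)
    finally have "((1 / 2) ^ e i0 n * cmod (a i0)) * cmod (a i0) \<le>
        ((1 / 2) ^ e i0 n * cmod (a i0)) * (norm g * (1 / 2) ^ e i0 n)"
      by (simp add: power2_eq_square mult_ac)
    then have "cmod (a i0) \<le> norm g * (1 / 2) ^ e i0 n"
      using I(3) by (subst (asm) mult_le_cancel_left_pos) auto
    also have "\<dots> \<le> norm g * (1 / 2) ^ n"
      by (intro mult_left_mono power_decreasing e_ge) auto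
    finally show ?thesis .
  qed
  have "(\<lambda>n. norm g * (1 / 2) ^ n) \<longlonglongrightarrow> norm g * 0"
    by (intro tendsto_intros LIMSEQ_power_zero) simp
  then have "cmod (a i0) \<le> norm g * 0"
    by (rule LIMSEQ_le_const) (use bound in blast)
  with I(3) show False
    by simp
qed


section \<open>Tridiagonal form of extended CMV matrices\<close>

lemma infsum_int_shift:
  fixes f :: "int \<Rightarrow> real"
  shows "(\<lambda>n. f (n - k)) summable_on UNIV \<longleftrightarrow> f summable_on UNIV"
    and "(\<Sum>\<^sub>\<infinity>n. f (n - k)) = (\<Sum>\<^sub>\<infinity>n. f n)"
proof -
  show "(\<lambda>n. f (n - k)) summable_on UNIV \<longleftrightarrow> f summable_on UNIV"
    by (rule summable_on_reindex_bij_witness[of UNIV "\<lambda>n. n + k" "\<lambda>n. n - k"]) auto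
  show "(\<Sum>\<^sub>\<infinity>n. f (n - k)) = (\<Sum>\<^sub>\<infinity>n. f n)"
    by (rule infsum_reindex_bij_witness[of UNIV "\<lambda>n. n + k" "\<lambda>n. n - k"]) auto
qed

lift_definition translate :: "int \<Rightarrow> int ell2 \<Rightarrow> int ell2" is "\<lambda>k f n. f (n - k)"
proof -
  fix k :: int and f :: "int \<Rightarrow> complex"
  assume "(\<lambda>n. (cmod (f n))\<^sup>2) summable_on UNIV"
  then show "(\<lambda>n. (cmod (f (n - k)))\<^sup>2) summable_on UNIV"
    using infsum_int_shift(1)[of "\<lambda>n. (cmod (f n))\<^sup>2" k] by simp
qed

lemma coord_translate [simp]: "ell2_coord (translate k u) n = ell2_coord u (n - k)"
  by transfer simp

lemma norm_translate [simp]: "norm (translate k u) = norm u"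
  by (simp add: norm_ell2_def infsum_int_shift(2)[of "\<lambda>n. (cmod (ell2_coord u n))\<^sup>2"])

text \<open>The parity is a parameter because odd translations exchange the two factors. The zero
  default makes the lifting total: for unrestricted coefficients square-summability may
  fail.\<close>

lift_definition Theta_op :: "(int \<Rightarrow> bool) \<Rightarrow> (int \<Rightarrow> complex) \<Rightarrow> int ell2 \<Rightarrow> int ell2" is
  "\<lambda>P a f. if \<forall>j. cmod (a j) \<le> 1 then Theta_sum P a f else (\<lambda>_. 0)"
proof -
  fix P :: "int \<Rightarrow> bool" and a :: "int \<Rightarrow> complex" and f :: "int \<Rightarrow> complex"
  assume "(\<lambda>i. (cmod (f i))\<^sup>2) summable_on UNIV"
  then have "ell2_coord (Abs_ell2 f) = f"
    by (simp add: Abs_ell2_inverse)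
  then show "(\<lambda>i. (cmod ((if \<forall>j. cmod (a j) \<le> 1 then Theta_sum P a f else (\<lambda>_. 0)) i))\<^sup>2)
      summable_on UNIV"
    using Theta_sum_summable_int[of a P "Abs_ell2 f"] by auto
qed

abbreviation rho :: "complex \<Rightarrow> complex" where
  "rho a \<equiv> complex_of_real (sqrt (1 - (cmod a)\<^sup>2))"

lemma Theta_sum_eq:
  "Theta_sum P a f n =
    (if P n then cnj (a n) * f n + rho (a n) * f (n + 1) else rho (a (n - 1)) * f (n - 1) - a (n - 1) * f n)"
  by (simp add: Theta_sum_def Theta_mult_vec)

lemma coord_Theta_op:
  assumes "\<And>j. cmod (a j) \<le> 1"
  shows "ell2_coord (Theta_op P a u) n =
    (if P n then cnj (a n) * ell2_coord u n + rho (a n) * ell2_coord u (n + 1)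
     else rho (a (n - 1)) * ell2_coord u (n - 1) - a (n - 1) * ell2_coord u n)"
  using assms by transfer (simp add: Theta_sum_eq)

lemma ext_CMV_eq:
  assumes "\<And>j. cmod (\<beta> j) \<le> 1"
  shows "ext_CMV \<beta> u = Theta_op even \<beta> (Theta_op odd \<beta> u)"
proof -
  have "ext_CMV_L \<beta> v = Theta_op even \<beta> v" "ext_CMV_M \<beta> v = Theta_op odd \<beta> v" for v
    using assms by (auto intro!: ell2_eqI
        simp: ell2_coord_ext_CMV_L ell2_coord_ext_CMV_M coord_Theta_op Theta_sum_eq)
  then show ?thesis
    by (simp add: ext_CMV_def)
qed

text \<open>The parity predicate moves along with the coefficients: an even \<open>k\<close>
  preserves \<open>even\<close> and \<open>odd\<close>, an odd \<open>k\<close> interchanges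
  them.\<close>

lemma translate_Theta_op:
  assumes "\<And>j. cmod (a j) \<le> 1"
  shows "Theta_op P a (translate k u) = translate k (Theta_op (\<lambda>n. P (n + k)) (\<lambda>n. a (n + k)) u)"
  by (rule ell2_eqI) (simp add: coord_Theta_op assms algebra_simps)

lemma rho_rho:
  assumes "cmod a \<le> 1"
  shows "rho a * rho a = 1 - a * cnj a"
proof -
  have "0 \<le> 1 - (cmod a)\<^sup>2"
    using assms by (simp add: power_le_one)
  then have "rho a * rho a = complex_of_real (1 - (cmod a)\<^sup>2)"
    by (simp flip: of_real_mult)
  also have "\<dots> = 1 - a * cnj a"
    by (simp only: of_real_diff of_real_1 complex_norm_square)
  finally show ?thesis .
qed

section \<open>Unitarity of the block operators\<close>

text \<open>To be read with \<open>b = a\<close>, \<open>c = cnj a\<close> and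
  \<open>r = rho a\<close>; conjugates are independent variables, which leaves pure ring identities.
  The first two invert the block, and the third, with conjugates for \<open>x'\<close> and
  \<open>y'\<close>, is its isometry.\<close>

lemma Theta_block_identities:
  fixes r b c :: "'a::comm_ring_1"
  assumes "r * r = 1 - b * c"
  shows "b * (c * x + r * y) + r * (r * x - b * y) = x"
    and "r * (c * x + r * y) - c * (r * x - b * y) = y"
    and "(c * x + r * y) * (b * x' + r * y') + (r * x - b * y) * (r * x' - c * y') = x * x' + y * y'"
proof -
  have *: "b * c + r * r = 1"
    using assms by simp
  have "b * (c * x + r * y) + r * (r * x - b * y) = (b * c + r * r) * x"
    "r * (c * x + r * y) - c * (r * x - b * y) = (b * c + r * r) * y"
    "(c * x + r * y) * (b * x' + r * y') + (r * x - b * y) * (r * x' - c * y') =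
      (b * c + r * r) * (x * x' + y * y')"
    by (simp_all add: algebra_simps)
  then show "b * (c * x + r * y) + r * (r * x - b * y) = x"
    and "r * (c * x + r * y) - c * (r * x - b * y) = y"
    and "(c * x + r * y) * (b * x' + r * y') + (r * x - b * y) * (r * x' - c * y') = x * x' + y * y'"
    by (simp_all add: *)
qed

definition alternating :: "(int \<Rightarrow> bool) \<Rightarrow> bool" where
  "alternating P \<longleftrightarrow> (\<forall>n. P (n + 1) \<longleftrightarrow> \<not> P n)"

lemma alternating_pred: "alternating P \<Longrightarrow> P (n - 1) \<longleftrightarrow> \<not> P n"
  by (metis alternating_def diff_add_cancel)

lemma alternating_even: "alternating even" and alternating_odd: "alternating odd"
  by (auto simp: alternating_def)

lemma alternating_not: "alternating P \<Longrightarrow> alternating (\<lambda>n. \<not> P n)"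
  by (simp add: alternating_def)

context
  fixes P :: "int \<Rightarrow> bool" and a :: "int \<Rightarrow> complex"
  assumes P: "alternating P" and a: "\<And>j. cmod (a j) \<le> 1"
begin

text \<open>Each block is a symmetric unitary matrix, so its inverse is its entrywise conjugate, the
  block of the conjugate coefficient.\<close>

lemma Theta_op_inverse: "Theta_op P (\<lambda>n. cnj (a n)) (Theta_op P a u) = u"
proof (rule ell2_eqI)
  fix n
  have s: "P (n + 1) \<longleftrightarrow> \<not> P n" "P (n - 1) \<longleftrightarrow> \<not> P n"
    using P alternating_pred[OF P] by (auto simp: alternating_def)
  show "ell2_coord (Theta_op P (\<lambda>n. cnj (a n)) (Theta_op P a u)) n = ell2_coord u n"
    using Theta_block_identities(1)[OF rho_rho[OF a]] Theta_block_identities(2)[OF rho_rho[OF a]]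
    by (simp add: coord_Theta_op a s)
qed

text \<open>
  Each block is unitary, so \<open>\<bar>(\<Theta> u) n\<bar>\<^sup>2 - \<bar>u n\<bar>\<^sup>2\<close> is of the form \<open>h n - h (n - 1)\<close> and sums to zero.
\<close>

lemma norm_Theta_op: "norm (Theta_op P a u) = norm u"
proof -
  let ?f = "\<lambda>n. (cmod (ell2_coord (Theta_op P a u) n))\<^sup>2" and ?g = "\<lambda>n. (cmod (ell2_coord u n))\<^sup>2"
  define h where "h n = (if P n then ?f n - ?g n else 0)" for n
  have s: "P (n + 1) \<longleftrightarrow> \<not> P n" "P (n - 1) \<longleftrightarrow> \<not> P n" for n
    using P alternating_pred[OF P] by (auto simp: alternating_def)
  have block: "(cmod (cnj b * x + rho b * y))\<^sup>2 + (cmod (rho b * x - b * y))\<^sup>2 = (cmod x)\<^sup>2 + (cmod y)\<^sup>2"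
    if "cmod b \<le> 1" for b x y
  proof -
    have "complex_of_real ((cmod (cnj b * x + rho b * y))\<^sup>2 + (cmod (rho b * x - b * y))\<^sup>2) =
        complex_of_real ((cmod x)\<^sup>2 + (cmod y)\<^sup>2)"
      unfolding of_real_add complex_norm_square
      using Theta_block_identities(3)[OF rho_rho[OF that], of x y "cnj x" "cnj y"] by simp
    then show ?thesis
      using of_real_eq_iff by blast
  qed
  have fg: "?f n - ?g n = h n - h (n - 1)" for n
  proof (cases "P n")
    case False
    then have "?f (n - 1) + ?f n = ?g (n - 1) + ?g n"
      using block[OF a, of "n - 1" "ell2_coord u (n - 1)" "ell2_coord u n"] by (simp add: coord_Theta_op a s)
    with False show ?thesis
      by (simp add: h_def s)
  qed (simp add: h_def s)
  have f: "?f summable_on UNIV" and g: "?g summable_on UNIV"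
    by (rule ell2_coord_summable)+
  have "(\<lambda>n. ?f n + ?g n) summable_on UNIV"
    using f g by (rule summable_on_add)
  then have "(\<lambda>n. norm (h n)) summable_on UNIV"
  proof (rule summable_on_comparison_test)
    show "norm (h n) \<le> ?f n + ?g n" for n
      using zero_le_power2[of "cmod (ell2_coord (Theta_op P a u) n)"] zero_le_power2[of "cmod (ell2_coord u n)"]
      unfolding h_def real_norm_def by (auto simp only: abs_le_iff if_split abs_zero split: if_split)
  qed auto
  then have h: "h summable_on UNIV"
    by (rule abs_summable_summable)
  have h': "(\<lambda>n. h (n - 1)) summable_on UNIV"
    using h by (simp add: infsum_int_shift(1))
  have "infsum ?f UNIV + (\<Sum>\<^sub>\<infinity>n. h (n - 1)) = (\<Sum>\<^sub>\<infinity>n. ?f n + h (n - 1))"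
    by (rule infsum_add[OF f h', symmetric])
  also have "(\<lambda>n. ?f n + h (n - 1)) = (\<lambda>n. ?g n + h n)"
  proof
    show "?f n + h (n - 1) = ?g n + h n" for n
      using fg[of n] by linarith
  qed
  also have "infsum \<dots> UNIV = infsum ?g UNIV + infsum h UNIV"
    by (rule infsum_add[OF g h])
  finally have "infsum ?f UNIV = infsum ?g UNIV"
    by (simp add: infsum_int_shift(2)[of h])
  then show ?thesis
    by (simp add: norm_ell2_def)
qed

end

lemma unitary_Theta_op:
  assumes P: "alternating P" and a: "\<And>j. cmod (a j) \<le> 1"
  shows "unitary (Theta_op P a)"
proof -
  have "Theta_op P a (u + v) = Theta_op P a u + Theta_op P a v"
    "Theta_op P a (c *\<^sub>C u) = c *\<^sub>C Theta_op P a u" for u v c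
    by (auto intro!: ell2_eqI simp: coord_Theta_op a algebra_simps)
  then have "bounded_clinear (Theta_op P a)"
    unfolding bounded_clinear_def
    by (auto intro!: bounded_linear_intro[where K = 1] simp: scaleR_scaleC norm_Theta_op[OF P a])
  moreover have "surj (Theta_op P a)"
    using Theta_op_inverse[OF P, of "\<lambda>n. cnj (a n)"] a by (intro surjI[of _ "Theta_op P (\<lambda>n. cnj (a n))"]) simp
  ultimately show ?thesis
    by (simp add: unitary_def norm_Theta_op[OF P a])
qed

lemma unitary_comp:
  assumes "unitary U" "unitary V"
  shows "unitary (\<lambda>u. U (V u))"
proof -
  have "surj (\<lambda>u. U (V u))"
    using comp_surj[OF unitary_surj[OF assms(2)] unitary_surj[OF assms(1)]] by (simp add: comp_def)
  then show ?thesis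
    using assms by (auto simp: unitary_def bounded_clinear_def bounded_linear_compose)
qed

text \<open>
  For the complementary parity \<open>Q\<close>, multiplying \<open>Theta_op Q a (Theta_op P a u) - z u\<close> by the inverse of
  \<open>Theta_op Q a\<close> gives a tridiagonal operator with the same norm.
\<close>

definition pencil :: "(int \<Rightarrow> bool) \<Rightarrow> (int \<Rightarrow> complex) \<Rightarrow> complex \<Rightarrow> int ell2 \<Rightarrow> int ell2" where
  "pencil P a z u = Theta_op P a u - z *\<^sub>C Theta_op (\<lambda>n. \<not> P n) (\<lambda>n. cnj (a n)) u"

lemma norm_pencil:
  assumes P: "alternating P" and a: "\<And>j. cmod (a j) \<le> 1"
  shows "norm (pencil P a z u) = norm (Theta_op (\<lambda>n. \<not> P n) a (Theta_op P a u) - z *\<^sub>C u)"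
proof -
  have U: "unitary (Theta_op (\<lambda>n. \<not> P n) a)"
    by (intro unitary_Theta_op alternating_not P a)
  have "norm (pencil P a z u) = norm (Theta_op (\<lambda>n. \<not> P n) a (pencil P a z u))"
    by (simp add: unitary_norm[OF U])
  also have "Theta_op (\<lambda>n. \<not> P n) a (Theta_op (\<lambda>n. \<not> P n) (\<lambda>n. cnj (a n)) u) = u"
    using Theta_op_inverse[OF alternating_not[OF P], of "\<lambda>n. cnj (a n)"] a by simp
  then have "Theta_op (\<lambda>n. \<not> P n) a (pencil P a z u) =
      Theta_op (\<lambda>n. \<not> P n) a (Theta_op P a u) - z *\<^sub>C u"
    by (simp add: pencil_def unitary_simps[OF U])
  finally show ?thesis .
qed

lemma norm_pencil_odd:
  assumes "\<And>j. cmod (a j) \<le> 1"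
  shows "norm (pencil odd a z u) = norm (ext_CMV a u - z *\<^sub>C u)"
  using norm_pencil[OF alternating_odd assms] by (simp add: ext_CMV_eq[OF assms])

text \<open>With \<open>M\<close> for the odd and \<open>L\<close> for the even factor,
  \<open>M (L M - z) = (M L - z) M\<close>. Once the factors are exchanged, \<open>M u\<close> is as
  good an approximate eigenvector as \<open>u\<close>.\<close>

lemma norm_pencil_even:
  assumes a: "\<And>j. cmod (a j) \<le> 1"
  shows "norm (pencil even a z (Theta_op odd a u)) = norm (ext_CMV a u - z *\<^sub>C u)"
proof -
  have U: "unitary (Theta_op odd a)"
    by (rule unitary_Theta_op[OF alternating_odd a])
  have "Theta_op odd a (Theta_op even a (Theta_op odd a u)) - z *\<^sub>C Theta_op odd a u =
      Theta_op odd a (ext_CMV a u - z *\<^sub>C u)"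
    by (simp add: unitary_simps[OF U] ext_CMV_eq[OF a])
  then show ?thesis
    using norm_pencil[OF alternating_even a] by (simp add: unitary_norm[OF U])
qed

lemma unitary_ext_CMV:
  assumes "\<And>j. cmod (\<beta> j) \<le> 1"
  shows "unitary (ext_CMV \<beta>)"
  using unitary_comp[OF unitary_Theta_op[OF alternating_even] unitary_Theta_op[OF alternating_odd]] assms
  by (simp add: ext_CMV_eq[OF assms, abs_def])

lemma coord_pencil:
  assumes "\<And>j. cmod (a j) \<le> 1"
  shows "ell2_coord (pencil P a z u) n =
    (if P n then cnj (a n) * ell2_coord u n + rho (a n) * ell2_coord u (n + 1)
        - z * (rho (a (n - 1)) * ell2_coord u (n - 1) - cnj (a (n - 1)) * ell2_coord u n)
     else rho (a (n - 1)) * ell2_coord u (n - 1) - a (n - 1) * ell2_coord u n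
        - z * (a n * ell2_coord u n + rho (a n) * ell2_coord u (n + 1)))"
  using assms by (simp add: pencil_def coord_Theta_op)

lemma coord_pencil_bound:
  assumes "\<And>j. cmod (a j) \<le> 1"
  shows "cmod (ell2_coord (pencil P a z u) n) \<le> (1 + cmod z) *
    (cmod (ell2_coord u (n - 1)) + cmod (ell2_coord u n) + cmod (ell2_coord u (n + 1)))"
proof -
  have r: "cmod (rho (a j)) \<le> 1" for j
    using assms[of j] by (simp add: power_le_one)
  have m: "cmod (p * x) \<le> cmod x" if "cmod p \<le> 1" for p x
    using that by (simp add: norm_mult mult_left_le_one_le)
  \<comment> \<open>A common shape for both parities: one block row of each of the two operators,
    with all entries of modulus at most 1.\<close>
  have 3: "cmod (p * x + q * y - z * (r * w - s * v)) \<le> cmod x + cmod y + cmod z * (cmod w + cmod v)"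
    if "cmod p \<le> 1" "cmod q \<le> 1" "cmod r \<le> 1" "cmod s \<le> 1" for p q r s x y w v
  proof -
    have "cmod (p * x + q * y - z * (r * w - s * v)) \<le> cmod (p * x + q * y) + cmod z * cmod (r * w - s * v)"
      using norm_triangle_ineq4 by (metis norm_mult)
    also have "cmod (p * x + q * y) \<le> cmod x + cmod y"
      using norm_triangle_ineq[of "p * x" "q * y"] m that by (smt (verit))
    also have "cmod (r * w - s * v) \<le> cmod w + cmod v"
      using norm_triangle_ineq4[of "r * w" "s * v"] m that by (smt (verit))
    finally show ?thesis
      by (simp add: mult_left_mono)
  qed
  let ?x = "cmod (ell2_coord u (n - 1))" and ?y = "cmod (ell2_coord u n)" and ?w = "cmod (ell2_coord u (n + 1))"
  have "cmod (ell2_coord (pencil P a z u) n) \<le> ?y + ?w + cmod z * (?x + ?y) \<or>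
      cmod (ell2_coord (pencil P a z u) n) \<le> ?x + ?y + cmod z * (?y + ?w)"
    using 3[of "cnj (a n)" "rho (a n)" "rho (a (n - 1))" "cnj (a (n - 1))"
        "ell2_coord u n" "ell2_coord u (n + 1)" "ell2_coord u (n - 1)" "ell2_coord u n"]
      3[of "rho (a (n - 1))" "- a (n - 1)" "a n" "- rho (a n)"
        "ell2_coord u (n - 1)" "ell2_coord u n" "ell2_coord u n" "ell2_coord u (n + 1)"]
      assms r unfolding coord_pencil[OF assms] by (cases "P n") simp_all
  moreover have "?y + ?w + cmod z * (?x + ?y) \<le> (1 + cmod z) * (?x + ?y + ?w)"
    "?x + ?y + cmod z * (?y + ?w) \<le> (1 + cmod z) * (?x + ?y + ?w)"
    by (simp_all add: algebra_simps)
  ultimately show ?thesis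
    by linarith
qed

lemma coord_pencil_cong:
  assumes "\<And>j. cmod (a j) \<le> 1"
    and "ell2_coord u (n - 1) = ell2_coord v (n - 1)" "ell2_coord u n = ell2_coord v n"
      "ell2_coord u (n + 1) = ell2_coord v (n + 1)"
  shows "ell2_coord (pencil P a z u) n = ell2_coord (pencil P a z v) n"
  using assms by (simp add: coord_pencil)


section \<open>Half-line CMV matrices\<close>

lemma infsum_int_of_nat:
  fixes g :: "nat \<Rightarrow> real"
  shows "(\<lambda>n::int. if 0 \<le> n then g (nat n) else 0) summable_on UNIV \<longleftrightarrow> g summable_on UNIV"
    and "(\<Sum>\<^sub>\<infinity>n::int. if 0 \<le> n then g (nat n) else 0) = (\<Sum>\<^sub>\<infinity>n. g n)"
proof -
  let ?f = "\<lambda>n::int. if 0 \<le> n then g (nat n) else 0"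
  have "?f summable_on UNIV \<longleftrightarrow> (\<lambda>n. g (nat n)) summable_on {0..}"
    by (rule summable_on_cong_neutral) auto
  also have "\<dots> \<longleftrightarrow> g summable_on UNIV"
    by (rule summable_on_reindex_bij_witness[of _ int nat]) auto
  finally show "?f summable_on UNIV \<longleftrightarrow> g summable_on UNIV" .
  have "infsum ?f UNIV = (\<Sum>\<^sub>\<infinity>n\<in>{0..}. g (nat n))"
    by (rule infsum_cong_neutral) auto
  also have "\<dots> = (\<Sum>\<^sub>\<infinity>n. g n)"
    by (rule infsum_reindex_bij_witness[of _ int nat]) auto
  finally show "infsum ?f UNIV = (\<Sum>\<^sub>\<infinity>n. g n)" .
qed

lift_definition emb :: "nat ell2 \<Rightarrow> int ell2" is "\<lambda>f n. if 0 \<le> n then f (nat n) else 0"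
proof -
  fix f :: "nat \<Rightarrow> complex"
  assume "(\<lambda>i. (cmod (f i))\<^sup>2) summable_on UNIV"
  moreover have "(\<lambda>n::int. (cmod (if 0 \<le> n then f (nat n) else 0))\<^sup>2) =
      (\<lambda>n. if 0 \<le> n then (cmod (f (nat n)))\<^sup>2 else 0)"
    by auto
  ultimately show "(\<lambda>n::int. (cmod (if 0 \<le> n then f (nat n) else 0))\<^sup>2) summable_on UNIV"
    by (simp add: infsum_int_of_nat(1)[of "\<lambda>n. (cmod (f n))\<^sup>2"])
qed

lemma coord_emb [simp]: "ell2_coord (emb u) n = (if 0 \<le> n then ell2_coord u (nat n) else 0)"
  by transfer simp

lemma norm_emb [simp]: "norm (emb u) = norm u"
proof -
  have "(\<lambda>n::int. (cmod (ell2_coord (emb u) n))\<^sup>2) =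
      (\<lambda>n. if 0 \<le> n then (cmod (ell2_coord u (nat n)))\<^sup>2 else 0)"
    by auto
  then show ?thesis
    by (simp add: norm_ell2_def infsum_int_of_nat(2)[of "\<lambda>n. (cmod (ell2_coord u n))\<^sup>2"])
qed

lemma emb_simps: "emb (u + v) = emb u + emb v" "emb (u - v) = emb u - emb v" "emb (c *\<^sub>C u) = c *\<^sub>C emb u"
  by (auto intro!: ell2_eqI)

lemma emb_eq_iff [simp]: "emb u = emb v \<longleftrightarrow> u = v"
proof
  assume "emb u = emb v"
  then have "norm (emb (u - v)) = 0"
    by (simp add: emb_simps)
  then show "u = v"
    by simp
qed simp

lemma emb_surj_on:
  assumes "\<And>n. n < 0 \<Longrightarrow> ell2_coord u n = 0"
  obtains v where "u = emb v"
proof -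
  let ?f = "\<lambda>n. ell2_coord u (int n)"
  have "(\<lambda>n::int. if 0 \<le> n then (cmod (?f (nat n)))\<^sup>2 else 0) = (\<lambda>n. (cmod (ell2_coord u n))\<^sup>2)"
    using assms by auto
  then have "(\<lambda>n. (cmod (?f n))\<^sup>2) summable_on UNIV"
    using ell2_coord_summable[of u] infsum_int_of_nat(1)[of "\<lambda>n. (cmod (?f n))\<^sup>2"] by simp
  then have "ell2_coord (Abs_ell2 ?f) = ?f"
    by (simp add: Abs_ell2_inverse)
  then have "u = emb (Abs_ell2 ?f)"
    using assms by (intro ell2_eqI) simp
  with that show ?thesis
    by blast
qed

text \<open>
  \<open>\<Theta>(-1)\<close> is diagonal with second entry \<open>1\<close>, so with \<open>-1\<close> at index \<open>-1\<close> the extended CMV matrix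
  decouples there and restricts to the half-line CMV matrix. The values further left are irrelevant.
\<close>

definition half_line :: "(nat \<Rightarrow> complex) \<Rightarrow> int \<Rightarrow> complex" where
  "half_line \<alpha> n = (if 0 \<le> n then \<alpha> (nat n) else -1)"

context
  fixes \<alpha> :: "nat \<Rightarrow> complex"
  assumes \<alpha>: "\<And>j. cmod (\<alpha> j) \<le> 1"
begin

lemma cmod_half_line: "cmod (half_line \<alpha> n) \<le> 1"
  using \<alpha> by (simp add: half_line_def)

lemma emb_CMV_L: "emb (CMV_L \<alpha> u) = Theta_op even (half_line \<alpha>) (emb u)"
proof (rule ell2_eqI)
  fix n :: int
  show "ell2_coord (emb (CMV_L \<alpha> u)) n = ell2_coord (Theta_op even (half_line \<alpha>) (emb u)) n"
  proof (cases "0 \<le> n")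
    case True
    then obtain k where "n = int k"
      using nonneg_int_cases by blast
    moreover have "nat (int k - 1) = k - 1" "nat (int k + 1) = k + 1"
      by auto
    ultimately show ?thesis
      by (cases "k = 0") (auto simp: coord_Theta_op[OF cmod_half_line] ell2_coord_CMV_L \<alpha> Theta_sum_def
          Theta_mult_vec half_line_def)
  next
    case False
    then have "n + 1 < 0 \<or> n = -1"
      by auto
    then show ?thesis
      using False by (auto simp: coord_Theta_op[OF cmod_half_line])
  qed
qed

lemma emb_CMV_M: "emb (CMV_M \<alpha> u) = Theta_op odd (half_line \<alpha>) (emb u)"
proof (rule ell2_eqI)
  fix n :: int
  show "ell2_coord (emb (CMV_M \<alpha> u)) n = ell2_coord (Theta_op odd (half_line \<alpha>) (emb u)) n"
  proof (cases "0 \<le> n")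
    case True
    then obtain k where "n = int k"
      using nonneg_int_cases by blast
    moreover have "nat (int k - 1) = k - 1" "nat (int k + 1) = k + 1"
      by auto
    ultimately show ?thesis
      by (cases "k = 0") (auto simp: coord_Theta_op[OF cmod_half_line] ell2_coord_CMV_M \<alpha> Theta_sum_def
          Theta_mult_vec half_line_def)
  next
    case False
    then have "n + 1 < 0 \<or> n = -1"
      by auto
    then show ?thesis
      using False by (auto simp: coord_Theta_op[OF cmod_half_line] half_line_def)
  qed
qed

lemma emb_CMV: "emb (CMV \<alpha> u) = ext_CMV (half_line \<alpha>) (emb u)"
  by (simp add: CMV_def emb_CMV_L emb_CMV_M ext_CMV_eq cmod_half_line)

end

lemma unitary_CMV:
  assumes \<alpha>: "\<And>j. cmod (\<alpha> j) \<le> 1"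
  shows "unitary (CMV \<alpha>)"
proof -
  note U = unitary_ext_CMV[OF cmod_half_line[OF \<alpha>]]
  note s = unitary_simps[OF U]
  have n: "norm (CMV \<alpha> u) = norm u" for u
    using norm_emb[of "CMV \<alpha> u"] by (simp add: emb_CMV \<alpha> unitary_norm[OF U] del: norm_emb) simp
  have add: "CMV \<alpha> (u + v) = CMV \<alpha> u + CMV \<alpha> v" for u v
    by (subst emb_eq_iff[symmetric]) (simp only: emb_CMV[OF \<alpha>] emb_simps s)
  have sc: "CMV \<alpha> (c *\<^sub>C u) = c *\<^sub>C CMV \<alpha> u" for c u
    by (subst emb_eq_iff[symmetric]) (simp only: emb_CMV[OF \<alpha>] emb_simps s)
  have "bounded_clinear (CMV \<alpha>)"
    unfolding bounded_clinear_def
    by (auto intro!: bounded_linear_intro[where K = 1] simp: scaleR_scaleC n add sc)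
  moreover have "surj (CMV \<alpha>)"
  proof (rule surjI)
    fix v
    \<comment> \<open>Surjectivity does not follow from the embedding, so a preimage is given
      explicitly by the conjugated coefficients. Conjugation commutes with \<open>half_line\<close>
      because -1 is real.\<close>
    let ?h = "half_line \<alpha>" and ?\<gamma> = "\<lambda>n. cnj (\<alpha> n)"
    have c: "half_line ?\<gamma> = (\<lambda>n. cnj (?h n))"
      by (auto simp: half_line_def)
    have inv: "Theta_op P ?h (Theta_op P (\<lambda>n. cnj (?h n)) w) = w" if "alternating P" for P w
      using Theta_op_inverse[OF that, of "\<lambda>n. cnj (?h n)"] cmod_half_line[OF \<alpha>] by simp
    have "emb (CMV \<alpha> (CMV_M ?\<gamma> (CMV_L ?\<gamma> v))) = emb v"
      by (simp add: emb_CMV emb_CMV_L emb_CMV_M \<alpha> ext_CMV_eq cmod_half_line c inv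
          alternating_even alternating_odd)
    then show "CMV \<alpha> (CMV_M ?\<gamma> (CMV_L ?\<gamma> v)) = v"
      by simp
  qed
  ultimately show ?thesis
    by (simp add: unitary_def n)
qed

text \<open>A strict inequality between continuous functions of the vector survives a small change,
  so approximate eigenvectors may be taken with finite support.\<close>

lemma unitary_shift_cut:
  assumes U: "unitary U" and u: "norm (U u - z *\<^sub>C u) < e * norm u" and e: "e > 0"
  obtains F where "finite F" "norm (U (cut F u) - z *\<^sub>C cut F u) < e * norm (cut F u)"
proof -
  \<comment> \<open>Removing a remainder of norm \<open>r\<close> raises the left side by at most
    \<open>(1 + cmod z) * r\<close> and lowers the right side by at most \<open>e * r\<close>;
    \<eta> is the available slack divided by the sum of these rates.\<close>
  define \<eta> where "\<eta> = (e * norm u - norm (U u - z *\<^sub>C u)) / (1 + cmod z + e)"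
  have d: "1 + cmod z + e > 0"
    using e by (simp add: add_nonneg_pos)
  have "\<eta> > 0"
    unfolding \<eta>_def using u d by simp
  then obtain F where F: "finite F" "norm (u - cut F u) < \<eta>"
    using cut_approx by blast
  let ?r = "u - cut F u"
  have "U (cut F u) - z *\<^sub>C cut F u = (U u - z *\<^sub>C u) - (U ?r - z *\<^sub>C ?r)"
    by (simp add: unitary_simps[OF U] ell2.scale_right_diff_distrib)
  then have 1: "norm (U (cut F u) - z *\<^sub>C cut F u) \<le> norm (U u - z *\<^sub>C u) + norm (U ?r - z *\<^sub>C ?r)"
    by (simp only: norm_triangle_ineq4)
  have 2: "norm (U ?r - z *\<^sub>C ?r) \<le> norm ?r + cmod z * norm ?r"
    using norm_triangle_ineq4[of "U ?r" "z *\<^sub>C ?r"] by (simp only: norm_scaleC unitary_norm[OF U])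
  have 3: "norm (U u - z *\<^sub>C u) + (norm ?r + cmod z * norm ?r) < e * norm u - e * norm ?r"
  proof -
    have "(1 + cmod z + e) * norm ?r < (1 + cmod z + e) * \<eta>"
      using F(2) d by (rule mult_strict_left_mono)
    also have "\<dots> = e * norm u - norm (U u - z *\<^sub>C u)"
      using d by (simp add: \<eta>_def)
    finally show ?thesis
      by (simp add: algebra_simps)
  qed
  have 4: "e * norm u - e * norm ?r \<le> e * norm (cut F u)"
  proof -
    have "norm u - norm ?r \<le> norm (cut F u)"
      using norm_triangle_ineq2[of u ?r] by simp
    then have "e * (norm u - norm ?r) \<le> e * norm (cut F u)"
      using e by (intro mult_left_mono) auto
    then show ?thesis
      by (simp only: right_diff_distrib)
  qed
  from 1 2 3 4 have "norm (U (cut F u) - z *\<^sub>C cut F u) < e * norm (cut F u)"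
    by linarith
  with F(1) show ?thesis
    by (rule that)
qed

section \<open>Escaping vectors and the essential spectrum\<close>

text \<open>Stated on the integers so that translations and \<open>pencil\<close> apply directly. As
  \<open>N\<close> is arbitrary, supports can be kept among the nonnegative indices, where the
  operator is the half-line CMV matrix.\<close>

definition escaping :: "(nat \<Rightarrow> complex) \<Rightarrow> complex \<Rightarrow> bool" where
  "escaping \<alpha> z \<longleftrightarrow> (\<forall>e>0. \<forall>N. \<exists>u M. u \<noteq> 0 \<and> (\<forall>n. ell2_coord u n \<noteq> 0 \<longrightarrow> N \<le> n \<and> n < M) \<and>
    norm (ext_CMV (half_line \<alpha>) u - z *\<^sub>C u) \<le> e * norm u)"

lemma essential_spectrum_CMV:
  assumes \<alpha>: "\<And>j. cmod (\<alpha> j) \<le> 1"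
  shows "essential_spectrum (CMV \<alpha>) = {z. escaping \<alpha> z}"
proof -
  have ne: "norm (ext_CMV (half_line \<alpha>) (emb v) - z *\<^sub>C emb v) = norm (CMV \<alpha> v - z *\<^sub>C v)" for v z
    using norm_emb[of "CMV \<alpha> v - z *\<^sub>C v"] by (simp only: emb_simps emb_CMV[OF \<alpha>])
  have "\<not> fredholm (\<lambda>u. CMV \<alpha> u - z *\<^sub>C u)" if z: "escaping \<alpha> z" for z
  proof (rule not_fredholm_if_escaping[OF unitary_CMV[OF \<alpha>]])
    fix e :: real and N :: nat
    assume "e > 0"
    then obtain u M where u: "u \<noteq> 0" "\<forall>n. ell2_coord u n \<noteq> 0 \<longrightarrow> int N \<le> n \<and> n < M"
        "norm (ext_CMV (half_line \<alpha>) u - z *\<^sub>C u) \<le> e * norm u"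
      using z unfolding escaping_def by blast
    then obtain v where v: "u = emb v"
      using emb_surj_on[of u] by fastforce
    have "N \<le> i \<and> i < nat M" if "ell2_coord v i \<noteq> 0" for i
      using u(2)[rule_format, of "int i"] that by (auto simp: v)
    moreover have "v \<noteq> 0"
      using u(1) v by (auto intro: ell2_eqI)
    ultimately show "\<exists>u M. u \<noteq> 0 \<and> (\<forall>i. ell2_coord u i \<noteq> 0 \<longrightarrow> N \<le> i \<and> i < M) \<and>
        norm (CMV \<alpha> u - z *\<^sub>C u) \<le> e * norm u"
      using u(3) unfolding v ne norm_emb by blast
  qed
  moreover have "fredholm (\<lambda>u. CMV \<alpha> u - z *\<^sub>C u)" if z: "\<not> escaping \<alpha> z" for z
  proof -
    obtain e N where e: "e > 0" and no: "\<And>u M. u \<noteq> 0 \<Longrightarrow> (\<And>n. ell2_coord u n \<noteq> 0 \<Longrightarrow> N \<le> n \<and> n < M) \<Longrightarrow>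
        \<not> norm (ext_CMV (half_line \<alpha>) u - z *\<^sub>C u) \<le> e * norm u"
      using z unfolding escaping_def by blast
    \<comment> \<open>The bound \<open>N\<close> may be negative; replacing it by
      \<open>nat N\<close> is harmless because embedded vectors vanish at negative indices. The
      bound is known for finite supports only, hence the passage to \<open>cut F u\<close>.\<close>
    have "e * norm u \<le> norm (CMV \<alpha> u - z *\<^sub>C u)" if u: "\<And>i. i < nat N \<Longrightarrow> ell2_coord u i = 0" for u
    proof (rule ccontr)
      assume "\<not> ?thesis"
      then have "norm (CMV \<alpha> u - z *\<^sub>C u) < e * norm u"
        by simp
      from unitary_shift_cut[OF unitary_CMV[of \<alpha>, OF \<alpha>] this e]
      obtain F where F: "finite F" "norm (CMV \<alpha> (cut F u) - z *\<^sub>C cut F u) < e * norm (cut F u)" .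
      have "N \<le> n \<and> n < int (Suc (Max F))" if "ell2_coord (emb (cut F u)) n \<noteq> 0" for n
      proof -
        have "0 \<le> n" "nat n \<in> F" "ell2_coord u (nat n) \<noteq> 0"
          using that by (auto split: if_splits)
        then show ?thesis
          using Max_ge[OF F(1), of "nat n"] u[of "nat n"] by linarith
      qed
      moreover have "emb (cut F u) \<noteq> 0"
        using F(2) by (metis norm_emb norm_ge_zero norm_zero mult_zero_right not_le)
      ultimately show False
        using no[of "emb (cut F u)"] F(2) unfolding ne norm_emb by force
    qed
    then show ?thesis
      by (rule fredholm_if_bounded_below_on_tail[OF unitary_CMV[OF \<alpha>] e])
  qed
  ultimately show ?thesis
    unfolding essential_spectrum_def by blast
qed

section \<open>Localisation to windows of fixed length\<close>

text \<open>Sum the hypothesis over all window positions. An index of the support lies in exactly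
  \<open>L\<close> windows, but it is near an edge for at most four positions. Away from the edges,
  cutting leaves the tridiagonal image unchanged inside the window and makes it zero outside. The
  constant is 36 = 4 * 3 * 3: four edge positions, a factor 3 from squaring a sum of three terms,
  and three shifted copies of \<open>norm u\<close>.\<close>

lemma pencil_localize:
  fixes u :: "int ell2" and L :: nat and \<eta> :: real
  assumes a: "\<And>j. cmod (a j) \<le> 1"
    and supp: "\<And>n. ell2_coord u n \<noteq> 0 \<Longrightarrow> p \<le> n \<and> n < q"
    and below: "\<And>j. \<eta> * (norm (cut {j..<j + int L} u))\<^sup>2 \<le> (norm (pencil P a z (cut {j..<j + int L} u)))\<^sup>2"
  shows "\<eta> * L * (norm u)\<^sup>2 \<le> L * (norm (pencil P a z u))\<^sup>2 + 36 * (1 + cmod z)\<^sup>2 * (norm u)\<^sup>2"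
proof -
  \<comment> \<open>\<open>?E j\<close> collects the indices with a neighbour on the other side of a
    window edge. Below, \<open>F\<close> is the support enlarged by one step on each side, and
    \<open>J\<close> contains every position whose window meets the support.\<close>
  let ?W = "\<lambda>j. {j..<j + int L}" and ?E = "\<lambda>j. {j - 1, j, j + int L - 1, j + int L}"
  define F where "F = {p - 1..q}"
  define J where "J = {p - int L - 1..q + 1}"
  define c where "c = 1 + cmod z"
  define s where "s n = (cmod (ell2_coord u n))\<^sup>2" for n
  define g where "g n = (cmod (ell2_coord (pencil P a z u) n))\<^sup>2" for n
  define D where "D n = 3 * c\<^sup>2 * (s (n - 1) + s n + s (n + 1))" for n
  have fin: "finite F" "finite J"
    by (auto simp: F_def J_def)
  have pos: "s n \<ge> 0" "g n \<ge> 0" "D n \<ge> 0" "c > 0" for n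
    by (auto simp: s_def g_def D_def c_def add_pos_nonneg)
  have out: "ell2_coord u n = 0 \<and> ell2_coord u (n - 1) = 0 \<and> ell2_coord u (n + 1) = 0" if "n \<notin> F" for n
    using that supp[of n] supp[of "n - 1"] supp[of "n + 1"] by (force simp: F_def)
  have nu: "(norm u)\<^sup>2 = (\<Sum>n\<in>F. s n)"
    unfolding s_def by (rule norm_ell2_finite_support) (use fin out in auto)
  have np: "(norm (pencil P a z u))\<^sup>2 = (\<Sum>n\<in>F. g n)"
    unfolding g_def by (rule norm_ell2_finite_support) (use fin out in \<open>auto simp: coord_pencil a\<close>)
  have nc: "(norm (cut (?W j) u))\<^sup>2 = (\<Sum>n\<in>F. if n \<in> ?W j then s n else 0)" for j
    by (subst norm_ell2_finite_support[of F]) (use fin out in \<open>auto simp: s_def intro!: sum.cong\<close>)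
  have npc: "(norm (pencil P a z (cut (?W j) u)))\<^sup>2 =
      (\<Sum>n\<in>F. (cmod (ell2_coord (pencil P a z (cut (?W j) u)) n))\<^sup>2)" for j
    by (rule norm_ell2_finite_support) (use fin out in \<open>auto simp: coord_pencil a\<close>)
  have ifnn: "0 \<le> (if b then x else 0)" if "0 \<le> x" for b and x :: real
    using that by simp
  have pt: "(cmod (ell2_coord (pencil P a z (cut (?W j) u)) n))\<^sup>2 \<le>
      (if n \<in> ?W j then g n else 0) + (if n \<in> ?E j then D n else 0)" for j n
  proof (cases "n \<in> ?E j")
    case True
    let ?x = "\<lambda>n. cmod (ell2_coord (cut (?W j) u) n)"
    have "(cmod (ell2_coord (pencil P a z (cut (?W j) u)) n))\<^sup>2 \<le> (c * (?x (n - 1) + ?x n + ?x (n + 1)))\<^sup>2"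
      unfolding c_def by (intro power_mono coord_pencil_bound a) auto
    also have "\<dots> = c\<^sup>2 * (?x (n - 1) + ?x n + ?x (n + 1))\<^sup>2"
      by (rule power_mult_distrib)
    also have "\<dots> \<le> c\<^sup>2 * (3 * ((?x (n - 1))\<^sup>2 + (?x n)\<^sup>2 + (?x (n + 1))\<^sup>2))"
    proof (rule mult_left_mono)
      have "(x + y + w)\<^sup>2 \<le> 3 * (x\<^sup>2 + y\<^sup>2 + w\<^sup>2)" for x y w :: real
        using sum_squares_bound[of x y] sum_squares_bound[of y w] sum_squares_bound[of x w]
        by (simp add: power2_eq_square algebra_simps)
      then show "(?x (n - 1) + ?x n + ?x (n + 1))\<^sup>2 \<le> 3 * ((?x (n - 1))\<^sup>2 + (?x n)\<^sup>2 + (?x (n + 1))\<^sup>2)" .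
    qed simp
    also have "\<dots> \<le> c\<^sup>2 * (3 * (s (n - 1) + s n + s (n + 1)))"
      by (intro mult_left_mono add_mono) (auto simp: s_def)
    also have "\<dots> = D n"
      by (simp add: D_def)
    finally show ?thesis
      using True pos(2)[of n] by (simp split: if_split)
  next
    case False
    show ?thesis
    proof (cases "n \<in> ?W j")
      case True
      then have "n - 1 \<in> ?W j" "n + 1 \<in> ?W j"
        using False by auto
      with True have "ell2_coord (pencil P a z (cut (?W j) u)) n = ell2_coord (pencil P a z u) n"
        by (intro coord_pencil_cong a) auto
      with True show ?thesis
        using pos(3)[of n] by (simp add: g_def)
    next
      case out: False
      then have "n - 1 \<notin> ?W j" "n + 1 \<notin> ?W j"
        using False by auto
      with out have "ell2_coord (cut (?W j) u) n = 0" "ell2_coord (cut (?W j) u) (n - 1) = 0"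
          "ell2_coord (cut (?W j) u) (n + 1) = 0"
        by (simp_all only: coord_cut if_False)
      then have "ell2_coord (pencil P a z (cut (?W j) u)) n = 0"
        by (simp add: coord_pencil a del: coord_cut)
      then have "(cmod (ell2_coord (pencil P a z (cut (?W j) u)) n))\<^sup>2 = 0"
        by (simp only: norm_zero zero_power2)
      then show ?thesis
        using ifnn[OF pos(2)[of n], of "n \<in> ?W j"] ifnn[OF pos(3)[of n], of "n \<in> ?E j"] by linarith
    qed
  qed
  have ifs: "(\<Sum>j\<in>J. if Q j then x else 0) = real (card {j \<in> J. Q j}) * x" for Q and x :: real
    using fin(2) by (simp add: sum.If_cases Int_def)
  have cW: "card {j \<in> J. n \<in> ?W j} \<le> L" for n
  proof -
    have "{j \<in> J. n \<in> ?W j} \<subseteq> {n - int L + 1..n}"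
      by auto
    from card_mono[OF _ this] show ?thesis
      by simp
  qed
  have cWeq: "card {j \<in> J. n \<in> ?W j} = L" if "s n \<noteq> 0" for n
  proof -
    have "p \<le> n" "n < q"
      using that supp[of n] by (auto simp: s_def)
    then have "{j \<in> J. n \<in> ?W j} = {n - int L + 1..n}"
      by (auto simp: J_def)
    then show ?thesis
      by simp
  qed
  have cE: "card {j \<in> J. n \<in> ?E j} \<le> 4" for n
  proof -
    have "{j \<in> J. n \<in> ?E j} \<subseteq> {n + 1, n, n - int L + 1, n - int L}"
      by auto
    from card_mono[OF _ this] show ?thesis
      using card_length[of "[n + 1, n, n - int L + 1, n - int L]"] by simp
  qed
  have Dsum: "(\<Sum>n\<in>F. D n) \<le> 9 * c\<^sup>2 * (norm u)\<^sup>2"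
  proof -
    have sh: "(\<Sum>n\<in>F. s (n + k)) \<le> (norm u)\<^sup>2" for k
    proof -
      have "(\<Sum>n\<in>F. s (n + k)) = (\<Sum>n\<in>(\<lambda>n. n + k) ` F. s n)"
        by (subst sum.reindex) auto
      also have "\<dots> \<le> (norm u)\<^sup>2"
        unfolding s_def by (rule sum_coord_le_norm) (use fin in simp)
      finally show ?thesis .
    qed
    have "(\<Sum>n\<in>F. D n) = 3 * c\<^sup>2 * ((\<Sum>n\<in>F. s (n + -1)) + (\<Sum>n\<in>F. s (n + 0)) + (\<Sum>n\<in>F. s (n + 1)))"
      by (simp add: D_def sum.distrib flip: sum_distrib_left)
    also have "\<dots> \<le> 3 * c\<^sup>2 * ((norm u)\<^sup>2 + (norm u)\<^sup>2 + (norm u)\<^sup>2)"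
      by (intro mult_left_mono add_mono sh) auto
    finally show ?thesis
      by simp
  qed
  have "\<eta> * L * (norm u)\<^sup>2 = \<eta> * (\<Sum>n\<in>F. \<Sum>j\<in>J. if n \<in> ?W j then s n else 0)"
  proof -
    have "(\<Sum>j\<in>J. if n \<in> ?W j then s n else 0) = L * s n" for n
      unfolding ifs using cWeq[of n] by (cases "s n = 0") auto
    then show ?thesis
      by (simp add: nu sum_distrib_left mult.assoc)
  qed
  also have "\<dots> = (\<Sum>j\<in>J. \<eta> * (norm (cut (?W j) u))\<^sup>2)"
    unfolding nc by (subst sum.swap) (simp add: sum_distrib_left)
  also have "\<dots> \<le> (\<Sum>j\<in>J. (norm (pencil P a z (cut (?W j) u)))\<^sup>2)"
    by (intro sum_mono below)
  also have "\<dots> \<le> (\<Sum>j\<in>J. \<Sum>n\<in>F. (if n \<in> ?W j then g n else 0) + (if n \<in> ?E j then D n else 0))"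
    unfolding npc by (intro sum_mono pt)
  also have "\<dots> = (\<Sum>n\<in>F. real (card {j \<in> J. n \<in> ?W j}) * g n + real (card {j \<in> J. n \<in> ?E j}) * D n)"
    by (subst sum.swap) (simp only: sum.distrib ifs)
  also have "\<dots> \<le> (\<Sum>n\<in>F. L * g n + 4 * D n)"
  proof (intro sum_mono add_mono mult_right_mono pos)
    fix n
    show "real (card {j \<in> J. n \<in> ?W j}) \<le> L" "real (card {j \<in> J. n \<in> ?E j}) \<le> 4"
      using cW[of n] cE[of n] by linarith+
  qed
  also have "\<dots> = L * (norm (pencil P a z u))\<^sup>2 + 4 * (\<Sum>n\<in>F. D n)"
    by (simp add: np sum.distrib sum_distrib_left)
  also have "\<dots> \<le> L * (norm (pencil P a z u))\<^sup>2 + 4 * (9 * c\<^sup>2 * (norm u)\<^sup>2)"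
    using Dsum by simp
  finally show ?thesis
    by (simp add: c_def)
qed


section \<open>Right limits\<close>

lemma exists_ell2_finite_support:
  assumes "finite F" "\<And>n. n \<notin> F \<Longrightarrow> f n = 0"
  obtains u where "\<And>n. ell2_coord u n = f n"
proof -
  have "(\<lambda>n. (cmod (f n))\<^sup>2) summable_on UNIV \<longleftrightarrow> (\<lambda>n. (cmod (f n))\<^sup>2) summable_on F"
    by (rule summable_on_cong_neutral) (use assms in auto)
  with assms(1) have "(\<lambda>n. (cmod (f n))\<^sup>2) summable_on UNIV"
    by simp
  then have "ell2_coord (Abs_ell2 f) n = f n" for n
    by (simp add: Abs_ell2_inverse)
  with that show ?thesis
    by blast
qed

lemma pencil_translate:
  assumes "\<And>j. cmod (a j) \<le> 1"
  shows "norm (pencil P a z (translate k u)) = norm (pencil (\<lambda>n. P (n + k)) (\<lambda>n. a (n + k)) z u)"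
proof -
  have "pencil P a z (translate k u) = translate k (pencil (\<lambda>n. P (n + k)) (\<lambda>n. a (n + k)) z u)"
    by (rule ell2_eqI) (simp add: pencil_def translate_Theta_op assms)
  then show ?thesis
    by simp
qed

text \<open>The common bounded support turns the norms into sums over one finite set, so pointwise
  convergence of coefficients and coordinates suffices.\<close>

lemma tendsto_norm_pencil:
  fixes u :: "nat \<Rightarrow> int ell2"
  assumes a: "\<And>k j. cmod (a k j) \<le> 1" "\<And>j. cmod (b j) \<le> 1" "\<And>j. (\<lambda>k. a k j) \<longlonglongrightarrow> b j"
    and u: "\<And>n. (\<lambda>k. ell2_coord (u k) n) \<longlonglongrightarrow> ell2_coord v n"
    and supp: "\<And>k n. n \<notin> {p..q} \<Longrightarrow> ell2_coord (u k) n = 0"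
  shows "(\<lambda>k. norm (pencil P (a k) z (u k))) \<longlonglongrightarrow> norm (pencil P b z v)"
proof -
  let ?F = "{p - 1..q + 1}"
  have suppv: "ell2_coord v n = 0" if "n \<notin> {p..q}" for n
    using LIMSEQ_unique[OF u[of n]] supp[OF that] by simp
  have nk: "(norm (pencil P (a k) z (u k)))\<^sup>2 = (\<Sum>n\<in>?F. (cmod (ell2_coord (pencil P (a k) z (u k)) n))\<^sup>2)" for k
    by (rule norm_ell2_finite_support) (auto simp: coord_pencil a supp)
  have nv: "(norm (pencil P b z v))\<^sup>2 = (\<Sum>n\<in>?F. (cmod (ell2_coord (pencil P b z v) n))\<^sup>2)"
    by (rule norm_ell2_finite_support) (auto simp: coord_pencil a suppv)
  have "(\<lambda>k. ell2_coord (pencil P (a k) z (u k)) n) \<longlonglongrightarrow> ell2_coord (pencil P b z v) n" for n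
    unfolding coord_pencil[of "a _", OF a(1)] coord_pencil[of b, OF a(2)]
    by (cases "P n") (auto intro!: tendsto_intros a(3) u)
  then have "(\<lambda>k. (norm (pencil P (a k) z (u k)))\<^sup>2) \<longlonglongrightarrow> (norm (pencil P b z v))\<^sup>2"
    unfolding nk nv by (intro tendsto_intros)
  from tendsto_real_sqrt[OF this] show ?thesis
    by simp
qed

lemma right_limit_point_cmod_le:
  assumes "right_limit_point \<alpha> \<beta>" "\<And>j. cmod (\<alpha> j) \<le> 1"
  shows "cmod (\<beta> j) \<le> 1"
proof -
  obtain m where "(\<lambda>i. \<alpha> (nat (int (m i) + j))) \<longlonglongrightarrow> \<beta> j"
    using assms(1) unfolding right_limit_point_def by blast
  then have "(\<lambda>i. cmod (\<alpha> (nat (int (m i) + j)))) \<longlonglongrightarrow> cmod (\<beta> j)"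
    by (rule tendsto_norm)
  then show ?thesis
    by (rule LIMSEQ_le_const2) (use assms(2) in auto)
qed

section \<open>Passage between the half line and its right limits\<close>

text \<open>The default value of \<open>half_line\<close> and the truncation by \<open>nat\<close>
  differ only at negative indices, which the translated positions eventually leave.\<close>

lemma tendsto_half_line_iff:
  assumes "filterlim m at_top sequentially"
  shows "(\<lambda>j. half_line \<alpha> (l + int (m j))) \<longlonglongrightarrow> b \<longleftrightarrow> (\<lambda>j. \<alpha> (nat (int (m j) + l))) \<longlonglongrightarrow> b"
proof (rule tendsto_cong)
  have "eventually (\<lambda>j. nat (- l) \<le> m j) sequentially"
    using assms by (simp add: filterlim_at_top)
  then show "eventually (\<lambda>j. half_line \<alpha> (l + int (m j)) = \<alpha> (nat (int (m j) + l))) sequentially"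
    by eventually_elim (auto simp: half_line_def add.commute)
qed

text \<open>
  Truncated approximate eigenvectors of the right limit are translated to the positions \<open>m j\<close>. For
  odd \<open>m j\<close> the translation exchanges the two factors of the CMV matrix; there \<open>Theta_op odd \<beta> u\<close>
  plays the role of \<open>u\<close>.
\<close>

lemma escaping_if_spectrum_right_limit:
  assumes \<alpha>: "\<And>j. cmod (\<alpha> j) \<le> 1" and rl: "right_limit_point \<alpha> \<beta>"
    and z: "z \<in> spectrum (ext_CMV \<beta>)"
  shows "escaping \<alpha> z"
  unfolding escaping_def
proof (intro allI impI)
  fix e :: real and N :: int
  assume e: "e > 0"
  have \<beta>: "cmod (\<beta> j) \<le> 1" for j
    using right_limit_point_cmod_le[OF rl \<alpha>] .
  note U = unitary_ext_CMV[of \<beta>, OF \<beta>]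
  obtain x where "x \<noteq> 0" "norm (ext_CMV \<beta> x - z *\<^sub>C x) \<le> (e / 2) * norm x"
    using approximate_eigenvectors_if_spectrum[OF U z, of "e / 2"] e by auto
  moreover from this have "(e / 2) * norm x < e * norm x"
    using e by simp
  ultimately have "norm (ext_CMV \<beta> x - z *\<^sub>C x) < e * norm x"
    by linarith
  then obtain F where F: "finite F"
      "norm (ext_CMV \<beta> (cut F x) - z *\<^sub>C cut F x) < e * norm (cut F x)"
    using unitary_shift_cut[OF U _ e] by blast
  define u where "u = cut F x"
  define w where "w = Theta_op odd \<beta> u"
  \<comment> \<open>The extra 1 leaves room for \<open>w\<close>, whose support may exceed that of
    \<open>u\<close> by one index on either side.\<close>
  define R where "R = Max (insert 0 (abs ` F)) + 1"
  have u0: "ell2_coord u n = 0" if "n \<notin> {- R + 1..R - 1}" for n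
  proof -
    have "n \<notin> F"
    proof
      assume "n \<in> F"
      then have "\<bar>n\<bar> \<le> R - 1"
        using F(1) by (simp add: R_def)
      with that show False
        by auto
    qed
    then show ?thesis
      by (simp add: u_def)
  qed
  have us: "ell2_coord u n = 0" if "n \<notin> {- R..R}" for n
    using u0[of n] that by auto
  have ws: "ell2_coord w n = 0" if "n \<notin> {- R..R}" for n
    using u0[of n] u0[of "n - 1"] u0[of "n + 1"] that by (auto simp: w_def coord_Theta_op \<beta>)
  have lt: "norm (ext_CMV \<beta> u - z *\<^sub>C u) < e * norm u"
    using F(2) by (simp add: u_def)
  have nw: "norm w = norm u"
    by (simp add: w_def norm_Theta_op alternating_odd \<beta>)
  obtain m where m: "filterlim m at_top sequentially"
      "\<And>l. (\<lambda>j. \<alpha> (nat (int (m j) + l))) \<longlonglongrightarrow> \<beta> l"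
    using rl unfolding right_limit_point_def by blast
  let ?a = "\<lambda>j n. half_line \<alpha> (n + int (m j))"
  have al: "(\<lambda>j. ?a j n) \<longlonglongrightarrow> \<beta> n" for n
    using m(2)[of n] tendsto_half_line_iff[OF m(1)] by blast
  have "(\<lambda>j. norm (pencil odd (?a j) z u)) \<longlonglongrightarrow> norm (pencil odd \<beta> z u)"
    by (rule tendsto_norm_pencil[where p = "- R" and q = R]) (auto simp: cmod_half_line \<alpha> \<beta> al us)
  then have 1: "eventually (\<lambda>j. norm (pencil odd (?a j) z u) < e * norm u) sequentially"
    by (rule order_tendstoD) (use lt in \<open>simp add: norm_pencil_odd \<beta>\<close>)
  have "(\<lambda>j. norm (pencil even (?a j) z w)) \<longlonglongrightarrow> norm (pencil even \<beta> z w)"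
    by (rule tendsto_norm_pencil[where p = "- R" and q = R]) (auto simp: cmod_half_line \<alpha> \<beta> al ws)
  then have 2: "eventually (\<lambda>j. norm (pencil even (?a j) z w) < e * norm u) sequentially"
    by (rule order_tendstoD) (use lt in \<open>simp add: norm_pencil_even \<beta> w_def\<close>)
  have 3: "eventually (\<lambda>j. nat (N + R) \<le> m j) sequentially"
    using m(1) by (simp add: filterlim_at_top)
  obtain j where j: "norm (pencil odd (?a j) z u) < e * norm u"
      "norm (pencil even (?a j) z w) < e * norm u" "nat (N + R) \<le> m j"
    using eventually_happens'[OF _ eventually_conj[OF 1 eventually_conj[OF 2 3]]] by auto
  define v where "v = (if even (m j) then u else w)"
  have vn: "norm v = norm u"
    by (simp add: v_def nw)
  have "norm (pencil odd (half_line \<alpha>) z (translate (int (m j)) v)) < e * norm u"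
    using j(1,2) by (simp add: pencil_translate cmod_half_line \<alpha> v_def)
  then have lt': "norm (ext_CMV (half_line \<alpha>) (translate (int (m j)) v) - z *\<^sub>C translate (int (m j)) v)
      < e * norm (translate (int (m j)) v)"
    by (simp add: norm_pencil_odd cmod_half_line \<alpha> vn)
  moreover from this have "translate (int (m j)) v \<noteq> 0"
    by (metis norm_ge_zero norm_zero mult_zero_right not_le)
  moreover have "N \<le> n \<and> n < int (m j) + R + 1" if "ell2_coord (translate (int (m j)) v) n \<noteq> 0" for n
  proof -
    have "n - int (m j) \<in> {- R..R}"
      using that us ws by (auto simp: v_def split: if_splits)
    then show ?thesis
      using j(3) by auto
  qed
  ultimately show "\<exists>u M. u \<noteq> 0 \<and> (\<forall>n. ell2_coord u n \<noteq> 0 \<longrightarrow> N \<le> n \<and> n < M) \<and>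
      norm (ext_CMV (half_line \<alpha>) u - z *\<^sub>C u) \<le> e * norm u"
    by (meson less_imp_le)
qed

text \<open>Accounts for the closure over all right limits: replacing \<open>y\<close> by
  \<open>z\<close> costs at most \<open>cmod (y - z) * norm u\<close>, whatever the vector.\<close>

lemma escaping_limit:
  assumes \<alpha>: "\<And>j. cmod (\<alpha> j) \<le> 1" and z: "\<And>e. e > 0 \<Longrightarrow> \<exists>y. escaping \<alpha> y \<and> dist y z < e"
  shows "escaping \<alpha> z"
  unfolding escaping_def
proof (intro allI impI)
  fix e :: real and N :: int
  assume e: "e > 0"
  obtain y where y: "escaping \<alpha> y" "dist y z < e / 2"
    using z[of "e / 2"] e by auto
  obtain u M where u: "u \<noteq> 0" "\<forall>n. ell2_coord u n \<noteq> 0 \<longrightarrow> N \<le> n \<and> n < M"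
      "norm (ext_CMV (half_line \<alpha>) u - y *\<^sub>C u) \<le> e / 2 * norm u"
    using y(1) e unfolding escaping_def by (meson half_gt_zero)
  have "ext_CMV (half_line \<alpha>) u - z *\<^sub>C u = (ext_CMV (half_line \<alpha>) u - y *\<^sub>C u) + (y - z) *\<^sub>C u"
    by (simp add: ell2.scale_left_diff_distrib)
  then have "norm (ext_CMV (half_line \<alpha>) u - z *\<^sub>C u) \<le>
      norm (ext_CMV (half_line \<alpha>) u - y *\<^sub>C u) + cmod (y - z) * norm u"
    by (metis norm_triangle_ineq norm_scaleC)
  also have "cmod (y - z) * norm u \<le> e / 2 * norm u"
    using y(2) by (intro mult_right_mono) (auto simp: dist_norm)
  finally have "norm (ext_CMV (half_line \<alpha>) u - z *\<^sub>C u) \<le> e * norm u"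
    using u(3) by simp
  with u show "\<exists>u M. u \<noteq> 0 \<and> (\<forall>n. ell2_coord u n \<noteq> 0 \<longrightarrow> N \<le> n \<and> n < M) \<and>
      norm (ext_CMV (half_line \<alpha>) u - z *\<^sub>C u) \<le> e * norm u"
    by blast
qed

text \<open>The point is the order of quantifiers: \<open>L\<close> is fixed before
  \<open>N\<close>. If every window failed, localisation would contradict the better accuracy
  \<open>e / 2\<close> of the escaping vector once \<open>L\<close> is large.\<close>

lemma escaping_windows:
  assumes \<alpha>: "\<And>j. cmod (\<alpha> j) \<le> 1" and z: "escaping \<alpha> z" and e: "e > 0"
  obtains L where "\<And>N :: int. \<exists>j v. N \<le> j \<and> even j \<and> norm v = 1 \<and>
    (\<forall>n. n \<notin> {j..j + L} \<longrightarrow> ell2_coord v n = 0) \<and> norm (pencil odd (half_line \<alpha>) z v) \<le> e"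
proof -
  define c where "c = 36 * (1 + cmod z)\<^sup>2"
  \<comment> \<open>The factor 3/4 is 1 minus the square of 1/2: what remains of
    \<open>e\<^sup>2 * L\<close> after subtracting the contribution of a vector of accuracy
    \<open>e / 2\<close>.\<close>
  obtain L :: nat where L: "c / (3 / 4 * e\<^sup>2) < L"
    using reals_Archimedean2 by blast
  have h: "cmod (half_line \<alpha> n) \<le> 1" for n
    using cmod_half_line[OF \<alpha>] .
  have "\<exists>j v. N \<le> j \<and> even j \<and> norm v = 1 \<and>
    (\<forall>n. n \<notin> {j..j + int L} \<longrightarrow> ell2_coord v n = 0) \<and> norm (pencil odd (half_line \<alpha>) z v) \<le> e" for N
  proof -
    \<comment> \<open>The margin \<open>L\<close> makes any window that meets the support start at
      \<open>N + 1\<close> or later; the 1 is used up by rounding to an even position.\<close>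
    obtain u M where u: "u \<noteq> 0" "\<And>n. ell2_coord u n \<noteq> 0 \<Longrightarrow> N + 1 + int L \<le> n \<and> n < M"
        "norm (ext_CMV (half_line \<alpha>) u - z *\<^sub>C u) \<le> e / 2 * norm u"
      using z e unfolding escaping_def by (meson half_gt_zero)
    have "\<exists>j. (norm (pencil odd (half_line \<alpha>) z (cut {j..<j + int L} u)))\<^sup>2 <
        e\<^sup>2 * (norm (cut {j..<j + int L} u))\<^sup>2"
    proof (rule ccontr)
      assume "\<not> ?thesis"
      then have "e\<^sup>2 * L * (norm u)\<^sup>2 \<le>
          L * (norm (pencil odd (half_line \<alpha>) z u))\<^sup>2 + 36 * (1 + cmod z)\<^sup>2 * (norm u)\<^sup>2"
        by (intro pencil_localize[where p = "N + 1 + int L" and q = M] h u(2)) (auto simp: not_less)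
      moreover have "(norm (pencil odd (half_line \<alpha>) z u))\<^sup>2 \<le> (e / 2 * norm u)\<^sup>2"
        using u(3) by (intro power_mono) (simp_all add: norm_pencil_odd h)
      then have "L * (norm (pencil odd (half_line \<alpha>) z u))\<^sup>2 \<le> L * (e / 2 * norm u)\<^sup>2"
        by (intro mult_left_mono) auto
      ultimately have "e\<^sup>2 * L * (norm u)\<^sup>2 \<le> L * (e / 2 * norm u)\<^sup>2 + c * (norm u)\<^sup>2"
        unfolding c_def by linarith
      also have "\<dots> = (L * (e\<^sup>2 / 4) + c) * (norm u)\<^sup>2"
        by (simp add: power_mult_distrib power_divide algebra_simps)
      finally have "e\<^sup>2 * L * (norm u)\<^sup>2 \<le> (L * (e\<^sup>2 / 4) + c) * (norm u)\<^sup>2" .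
      then have "e\<^sup>2 * L \<le> L * (e\<^sup>2 / 4) + c"
        using u(1) by simp
      moreover have "c < 3 / 4 * e\<^sup>2 * L"
        using L e by (simp add: pos_divide_less_eq mult.commute)
      ultimately show False
        by (simp add: algebra_simps)
    qed
    then obtain j where j: "(norm (pencil odd (half_line \<alpha>) z (cut {j..<j + int L} u)))\<^sup>2 <
        (e * norm (cut {j..<j + int L} u))\<^sup>2"
      by (auto simp: power_mult_distrib)
    define x where "x = cut {j..<j + int L} u"
    have x: "norm (pencil odd (half_line \<alpha>) z x) < e * norm x"
      unfolding x_def by (rule power2_less_imp_less[OF j]) (use e in simp)
    have x0: "x \<noteq> 0"
      using x by (metis norm_ge_zero norm_zero mult_zero_right not_le)
    then obtain n where n: "ell2_coord x n \<noteq> 0"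
      using ell2_eqI[of x 0] by auto
    then have jN: "N + 1 \<le> j"
      using u(2)[of n] by (auto simp: x_def split: if_splits)
    \<comment> \<open>Even positions make the later translation preserve parity. The closed interval
      from \<open>k\<close> to \<open>k + L\<close> still contains the window when \<open>k\<close>
      is \<open>j - 1\<close>.\<close>
    define k where "k = (if even j then j else j - 1)"
    have k: "even k" "N \<le> k" "k \<le> j" "j \<le> k + 1"
      using jN by (auto simp: k_def)
    define v where "v = complex_of_real (1 / norm x) *\<^sub>C x"
    have r: "cmod (complex_of_real (1 / norm x)) = 1 / norm x"
      by (simp add: norm_divide)
    have "norm v = 1"
      using x0 by (simp only: v_def norm_scaleC r) simp
    moreover have eq: "norm (pencil odd (half_line \<alpha>) z v) = (1 / norm x) * norm (pencil odd (half_line \<alpha>) z x)"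
    proof -
      note U = unitary_ext_CMV[of "half_line \<alpha>", OF h]
      have "ext_CMV (half_line \<alpha>) v - z *\<^sub>C v =
          complex_of_real (1 / norm x) *\<^sub>C (ext_CMV (half_line \<alpha>) x - z *\<^sub>C x)"
        by (simp only: v_def unitary_simps[OF U] ell2.scale_right_diff_distrib ell2.scale_scale mult.commute)
      then show ?thesis
        by (simp only: norm_pencil_odd[OF h] norm_scaleC r)
    qed
    have "norm (pencil odd (half_line \<alpha>) z v) \<le> e"
      unfolding eq using x x0 by (simp add: pos_divide_le_eq)
    moreover have "\<forall>n. n \<notin> {k..k + int L} \<longrightarrow> ell2_coord v n = 0"
      using k by (auto simp: v_def x_def)
    ultimately show ?thesis
      using k by blast
  qed
  with that show ?thesis
    by blast
qed

text \<open>After translation all window vectors live on \<open>{0..L}\<close>, so a subsequence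
  converges together with the translated coefficients. The limit vector is a unit vector of accuracy
  \<open>e\<close> for a right limit.\<close>

lemma spectrum_right_limit_near_escaping:
  assumes \<alpha>: "\<And>j. cmod (\<alpha> j) \<le> 1" and z: "escaping \<alpha> z" and e: "e > 0"
  shows "\<exists>\<beta>. right_limit_point \<alpha> \<beta> \<and> (\<exists>w\<in>spectrum (ext_CMV \<beta>). cmod (w - z) \<le> e)"
proof -
  have h: "cmod (half_line \<alpha> n) \<le> 1" for n
    using cmod_half_line[OF \<alpha>] .
  \<comment> \<open>An isometry has no approximate eigenvectors at 0; accuracy 1/2 is already a
    contradiction.\<close>
  have z0: "z \<noteq> 0"
  proof
    assume "z = 0"
    have "\<forall>N. \<exists>u M. u \<noteq> 0 \<and> (\<forall>n. ell2_coord u n \<noteq> 0 \<longrightarrow> N \<le> n \<and> n < M) \<and>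
        norm (ext_CMV (half_line \<alpha>) u - z *\<^sub>C u) \<le> 1 / 2 * norm u"
      using z unfolding escaping_def by (metis half_gt_zero zero_less_one)
    then obtain u where "u \<noteq> 0" "norm (ext_CMV (half_line \<alpha>) u - z *\<^sub>C u) \<le> 1 / 2 * norm u"
      by blast
    with \<open>z = 0\<close> show False
      by (simp add: unitary_norm[OF unitary_ext_CMV[of "half_line \<alpha>", OF h]])
  qed
  obtain L where L: "\<And>N :: int. \<exists>j v. N \<le> j \<and> even j \<and> norm v = 1 \<and>
    (\<forall>n. n \<notin> {j..j + L} \<longrightarrow> ell2_coord v n = 0) \<and> norm (pencil odd (half_line \<alpha>) z v) \<le> e"
    using escaping_windows[OF \<alpha> z e] by blast
  define Q where "Q N j v \<longleftrightarrow> N \<le> j \<and> even j \<and> norm v = 1 \<and>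
    (\<forall>n. n \<notin> {j..j + L} \<longrightarrow> ell2_coord v n = 0) \<and> norm (pencil odd (half_line \<alpha>) z v) \<le> e"
    for N j :: int and v
  have "\<exists>j v. Q (int k) j v" for k
    using L unfolding Q_def .
  then obtain j v where "\<And>k. Q (int k) (j k) (v k)"
    by metis
  then have j: "int k \<le> j k" "even (j k)" and v: "norm (v k) = 1"
    "\<And>n. n \<notin> {j k..j k + L} \<Longrightarrow> ell2_coord (v k) n = 0"
    "norm (pencil odd (half_line \<alpha>) z (v k)) \<le> e" for k
    unfolding Q_def by blast+
  define w where "w k = translate (- j k) (v k)" for k
  define a where "a k n = half_line \<alpha> (n + j k)" for k n
  have w1: "norm (w k) = 1" for k
    by (simp add: w_def v)
  have ws: "ell2_coord (w k) n = 0" if "n \<notin> {0..L}" for k n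
    using that v(2)[of "n + j k" k] by (auto simp: w_def)
  have wp: "norm (pencil odd (a k) z (w k)) \<le> e" for k
  proof -
    have "v k = translate (j k) (w k)"
      by (rule ell2_eqI) (simp add: w_def)
    then have "norm (pencil odd (half_line \<alpha>) z (v k)) = norm (pencil odd (a k) z (w k))"
      using j(2)[of k] by (simp add: pencil_translate h a_def[abs_def])
    then show ?thesis
      using v(3)[of k] by simp
  qed
  have a1: "cmod (a k n) \<le> 1" for k n
    by (simp add: a_def h)
  \<comment> \<open>The sum type joins coefficients and coordinates in one bounded family, so a
    single diagonal extraction handles both.\<close>
  define f where "f k x = (case x of Inl n \<Rightarrow> a k n | Inr n \<Rightarrow> ell2_coord (w k) n)" for k and x :: "int + int"
  have "norm (f k x) \<le> 1" for k x
    using a1 cmod_coord_le_norm[of "w k"] w1 by (auto simp: f_def split: sum.split)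
  then obtain r where r: "strict_mono (r :: nat \<Rightarrow> nat)" "\<And>x. \<exists>l. (\<lambda>k. f (r k) x) \<longlonglongrightarrow> l"
    by (rule function_convergent_subsequence[OF countableI_type[of UNIV], of f 1]) blast
  have "\<exists>g. \<forall>x. (\<lambda>k. f (r k) x) \<longlonglongrightarrow> g x"
    by (intro choice allI r(2))
  then obtain g where g: "\<And>x. (\<lambda>k. f (r k) x) \<longlonglongrightarrow> g x"
    by blast
  define \<beta> where "\<beta> n = g (Inl n)" for n
  have \<beta>: "(\<lambda>k. a (r k) n) \<longlonglongrightarrow> \<beta> n" for n
    using g[of "Inl n"] by (simp add: f_def \<beta>_def)
  have gw: "(\<lambda>k. ell2_coord (w (r k)) n) \<longlonglongrightarrow> g (Inr n)" for n
    using g[of "Inr n"] by (simp add: f_def)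
  have "g (Inr n) = 0" if "n \<notin> {0..L}" for n
    using LIMSEQ_unique[OF gw[of n]] ws[OF that] by simp
  then obtain y where y: "\<And>n. ell2_coord y n = g (Inr n)"
    using exists_ell2_finite_support[of "{0..L}" "\<lambda>n. g (Inr n)"] by blast
  have lim: "(\<lambda>k. ell2_coord (w (r k)) n) \<longlonglongrightarrow> ell2_coord y n" for n
    using gw by (simp add: y)
  have ys: "ell2_coord y n = 0" if "n \<notin> {0..L}" for n
    using LIMSEQ_unique[OF lim[of n]] ws[OF that] by simp
  \<comment> \<open>No mass is lost in the limit because all vectors are supported in the fixed
    finite set \<open>{0..L}\<close>.\<close>
  have y1: "norm y = 1"
  proof -
    have "(\<lambda>k. \<Sum>n\<in>{0..L}. (cmod (ell2_coord (w (r k)) n))\<^sup>2) \<longlonglongrightarrow> (\<Sum>n\<in>{0..L}. (cmod (ell2_coord y n))\<^sup>2)"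
      by (intro tendsto_intros lim)
    moreover have "(\<Sum>n\<in>{0..L}. (cmod (ell2_coord (w (r k)) n))\<^sup>2) = 1" for k
      using norm_ell2_finite_support[of "{0..L}" "w (r k)"] ws w1 by simp
    moreover have "(\<Sum>n\<in>{0..L}. (cmod (ell2_coord y n))\<^sup>2) = (norm y)\<^sup>2"
      using norm_ell2_finite_support[of "{0..L}" y] ys by simp
    ultimately have "(\<lambda>k::nat. 1) \<longlonglongrightarrow> (norm y)\<^sup>2"
      by simp
    then have "(norm y)\<^sup>2 = 1"
      using LIMSEQ_unique tendsto_const by blast
    then show ?thesis
      by (simp add: power2_eq_1_iff) (metis norm_ge_zero not_one_le_zero neg_0_le_iff_le)
  qed
  define m where "m k = nat (j (r k))" for k
  have jm: "j (r k) = int (m k)" for k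
    using j(1)[of "r k"] by (simp add: m_def)
  have "k \<le> m k" for k
    using j(1)[of "r k"] seq_suble[OF r(1), of k] jm[of k] by linarith
  then have m: "filterlim m at_top sequentially"
    by (intro filterlim_at_top_mono[OF filterlim_ident]) auto
  have rl: "right_limit_point \<alpha> \<beta>"
    unfolding right_limit_point_def
  proof (intro exI[of _ m] conjI m allI)
    fix l
    show "(\<lambda>k. \<alpha> (nat (int (m k) + l))) \<longlonglongrightarrow> \<beta> l"
      using \<beta>[of l] tendsto_half_line_iff[OF m] by (simp add: a_def jm)
  qed
  have \<beta>1: "cmod (\<beta> n) \<le> 1" for n
    using right_limit_point_cmod_le[OF rl \<alpha>] .
  have "(\<lambda>k. norm (pencil odd (a (r k)) z (w (r k)))) \<longlonglongrightarrow> norm (pencil odd \<beta> z y)"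
    by (rule tendsto_norm_pencil[where p = 0 and q = L]) (use a1 \<beta>1 \<beta> lim ws in auto)
  then have "norm (pencil odd \<beta> z y) \<le> e"
    by (rule LIMSEQ_le_const2) (use wp in blast)
  then have "norm (ext_CMV \<beta> y - z *\<^sub>C y) \<le> e * norm y"
    by (simp add: norm_pencil_odd \<beta>1 y1)
  moreover have "y \<noteq> 0"
    using y1 by auto
  ultimately have "\<exists>w\<in>spectrum (ext_CMV \<beta>). cmod (w - z) \<le> e"
    using unitary_spectrum_near[OF unitary_ext_CMV[of \<beta>, OF \<beta>1] z0] by blast
  with rl show ?thesis
    by blast
qed

theorem theorem3p1:
  fixes \<alpha> :: "nat \<Rightarrow> complex"
  assumes "\<And>j. cmod (\<alpha> j) < 1"
    and "(SUP j. cmod (\<alpha> j)) < 1"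
  shows "essential_spectrum (CMV \<alpha>) = closure (\<Union>T\<in>right_limits \<alpha>. spectrum T)"
proof -
  have \<alpha>: "cmod (\<alpha> j) \<le> 1" for j
    using assms(1)[of j] by simp
  let ?S = "\<Union>T\<in>right_limits \<alpha>. spectrum T"
  have "z \<in> closure ?S \<longleftrightarrow> escaping \<alpha> z" for z
  proof
    assume z: "z \<in> closure ?S"
    show "escaping \<alpha> z"
    proof (rule escaping_limit[OF \<alpha>])
      fix e :: real
      assume "e > 0"
      then obtain y where "y \<in> ?S" "dist y z < e"
        using z closure_approachable by blast
      moreover from this obtain \<beta> where "right_limit_point \<alpha> \<beta>" "y \<in> spectrum (ext_CMV \<beta>)"
        unfolding right_limits_def by blast
      ultimately show "\<exists>y. escaping \<alpha> y \<and> dist y z < e"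
        using escaping_if_spectrum_right_limit[of \<alpha>, OF \<alpha>] by blast
    qed
  next
    assume z: "escaping \<alpha> z"
    have "\<exists>y\<in>?S. dist y z < e" if e: "e > 0" for e
    proof -
      obtain \<beta> w where "right_limit_point \<alpha> \<beta>" "w \<in> spectrum (ext_CMV \<beta>)" "cmod (w - z) \<le> e / 2"
        using spectrum_right_limit_near_escaping[of \<alpha> z "e / 2", OF \<alpha> z] half_gt_zero[OF e] by blast
      then show ?thesis
        using e by (intro bexI[of _ w]) (auto simp: dist_norm right_limits_def)
    qed
    then show "z \<in> closure ?S"
      by (simp add: closure_approachable)
  qed
  then show ?thesis
    using essential_spectrum_CMV[of \<alpha>, OF \<alpha>] by blast
qed

end
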